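(* Consider the spectral problem $$\varphi_x=\begin{pmatrix}\lambda&u\\-u&-\lambda\end{pmatrix}\varphi,\qquad \varphi=(\varphi_1,\varphi_2)^t ,$$ with $u$ given by either of the two periodic waves $$u(x)=u_4+\frac{(u_1-u_4)(u_2-u_4)}{(u_2-u_4)+(u_1-u_2)\,\mathrm{sn}^2(\nu x;\kappa)}\qquad (A)$$ or $$u(x)=a+\frac{(b-a)(1-\mathrm{cn}(\nu x;\kappa))}{1+\delta+(\delta-1)\,\mathrm{cn}(\nu x;\kappa)}\qquad (B).$$ The spectral problem admits three pairs $\pm\lambda_1,\pm\lambda_2,\pm\lambda_3$ of eigenvalues with $\mathrm{Re}(\lambda)\ne0$ that correspond to periodic eigenfunctions $\varphi$ of the same period. For the periodic wave (A), the eigenvalues are located at $$\lambda_1=\tfrac12(u_1+u_2),\quad \lambda_2=\tfrac12(u_1+u_3),\quad \lambda_3=\tfrac12(u_2+u_3).$$ For the periodic wave (B), the eigenvalues are located at $$\lambda_1=\tfrac14(a-b)+\tfrac i2\beta,\quad \lambda_2=\tfrac14(a-b)-\tfrac i2\beta,\quad \lambda_3=\tfrac12(a+b).$$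
   Context: $\mathrm{sn}(\cdot;\kappa)$, $\mathrm{cn}(\cdot;\kappa)$ are the Jacobian elliptic functions with modulus $\kappa$. The waves are periodic solutions of $u''+2u^3-cu=e$ and $(u')^2+u^4-cu^2+d=2eu$ with real parameters $(c,d,e)$, i.e. profiles of travelling waves $u(x-ct)$ of the modified Korteweg--de Vries equation $u_t+6u^2u_x+u_{xxx}=0$. Let $P(u)=u^4-cu^2+d-2eu$. In (A), $P$ has four real roots $u_4\le u_3\le u_2\le u_1$ (so $u_1+u_2+u_3+u_4=0$), and $\nu>0$, $\kappa\in(0,1)$ are given by $4\nu^2=(u_1-u_3)(u_2-u_4)$, $4\nu^2\kappa^2=(u_1-u_2)(u_3-u_4)$. In (B), $P$ has two real roots $b\le a$ and two complex-conjugate roots $\alpha\pm i\beta$ (so $a+b+2\alpha=0$), and $\delta>0$, $\nu>0$, $\kappa\in(0,1)$ are given by $$\delta^2=\frac{(b-\alpha)^2+\beta^2}{(a-\alpha)^2+\beta^2},\quad \nu^2=\sqrt{[(a-\alpha)^2+\beta^2][(b-\alpha)^2+\beta^2]},\quad 2\kappa^2=1-\frac{(a-\alpha)(b-\alpha)+\beta^2}{\sqrt{[(a-\alpha)^2+\beta^2][(b-\alpha)^2+\beta^2]}} .$$ An eigenvalue with a periodic eigenfunction means a value $\lambda\in\mathbb{C}$ for which the linear system has a nonzero periodic solution $\varphi$; "the same period" refers to the period of the wave $u$.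
   Formalization: With L the least period of u, all six eigenfunctions are proved periodic with period 2L; period L only for ±λ1 in (A) and ±λ3 in (B), as the others are L-antiperiodic. Re λ3≠0 and distinctness of the three pairs are claimed only for e≠0, since λ3=0 when e=0. *)

theory Defs
  imports
    "HOL-Analysis.Analysis"
    "HOL-Computational_Algebra.Polynomial"
    "HOL-Library.Periodic_Fun"
begin

text \<open>
  Jacobi elliptic functions with modulus \<open>\<kappa>\<close> (so \<open>\<kappa>\<^sup>2\<close> is the parameter), \<open>\<bar>\<kappa>\<bar> < 1\<close>. The incomplete
  elliptic integral is oriented (odd in \<open>\<phi>\<close>) and is then an increasing bijection of the real line;
  the amplitude is its inverse.
\<close>

definition ellipticF :: "real \<Rightarrow> real \<Rightarrow> real" where
  "ellipticF \<kappa> \<phi> = (LBINT t=ereal 0..ereal \<phi>. 1 / sqrt (1 - \<kappa>\<^sup>2 * (sin t)\<^sup>2))"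

definition jacobi_am :: "real \<Rightarrow> real \<Rightarrow> real" where
  "jacobi_am \<kappa> x = (THE \<phi>. ellipticF \<kappa> \<phi> = x)"

definition jacobi_sn :: "real \<Rightarrow> real \<Rightarrow> real" where
  "jacobi_sn \<kappa> x = sin (jacobi_am \<kappa> x)"

definition jacobi_cn :: "real \<Rightarrow> real \<Rightarrow> real" where
  "jacobi_cn \<kappa> x = cos (jacobi_am \<kappa> x)"

text \<open>The travelling waves satisfy \<open>(u')\<^sup>2 + P(u) = 0\<close> with this quartic \<open>P\<close>.\<close>

definition mkdv_quartic :: "real \<Rightarrow> real \<Rightarrow> real \<Rightarrow> real poly" where
  "mkdv_quartic c d e = [:d, - 2 * e, - c, 0, 1:]"

definition wave_A_params ::
    "real \<Rightarrow> real \<Rightarrow> real \<Rightarrow> real \<Rightarrow> real \<Rightarrow> real \<Rightarrow> real \<Rightarrow> real \<Rightarrow> real \<Rightarrow> bool" where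
  "wave_A_params c d e u1 u2 u3 u4 \<nu> \<kappa> \<longleftrightarrow>
     mkdv_quartic c d e = [:- u1, 1:] * [:- u2, 1:] * [:- u3, 1:] * [:- u4, 1:] \<and>
     u4 \<le> u3 \<and> u3 \<le> u2 \<and> u2 \<le> u1 \<and>
     0 < \<nu> \<and> 0 < \<kappa> \<and> \<kappa> < 1 \<and>
     4 * \<nu>\<^sup>2 = (u1 - u3) * (u2 - u4) \<and>
     4 * \<nu>\<^sup>2 * \<kappa>\<^sup>2 = (u1 - u2) * (u3 - u4)"

definition wave_A :: "real \<Rightarrow> real \<Rightarrow> real \<Rightarrow> real \<Rightarrow> real \<Rightarrow> real \<Rightarrow> real" where
  "wave_A u1 u2 u4 \<nu> \<kappa> x =
     u4 + (u1 - u4) * (u2 - u4) / ((u2 - u4) + (u1 - u2) * (jacobi_sn \<kappa> (\<nu> * x))\<^sup>2)"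

definition wave_B_params ::
    "real \<Rightarrow> real \<Rightarrow> real \<Rightarrow> real \<Rightarrow> real \<Rightarrow> real \<Rightarrow> real \<Rightarrow> real \<Rightarrow> real \<Rightarrow> real \<Rightarrow> bool" where
  "wave_B_params c d e a b \<alpha> \<beta> \<delta> \<nu> \<kappa> \<longleftrightarrow>
     map_poly complex_of_real (mkdv_quartic c d e) =
       [:- complex_of_real a, 1:] * [:- complex_of_real b, 1:] *
       [:- Complex \<alpha> \<beta>, 1:] * [:- Complex \<alpha> (- \<beta>), 1:] \<and>
     b \<le> a \<and> \<beta> \<noteq> 0 \<and>
     0 < \<delta> \<and> 0 < \<nu> \<and> 0 < \<kappa> \<and> \<kappa> < 1 \<and>
     \<delta>\<^sup>2 = ((b - \<alpha>)\<^sup>2 + \<beta>\<^sup>2) / ((a - \<alpha>)\<^sup>2 + \<beta>\<^sup>2) \<and>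
     \<nu>\<^sup>2 = sqrt (((a - \<alpha>)\<^sup>2 + \<beta>\<^sup>2) * ((b - \<alpha>)\<^sup>2 + \<beta>\<^sup>2)) \<and>
     2 * \<kappa>\<^sup>2 = 1 - ((a - \<alpha>) * (b - \<alpha>) + \<beta>\<^sup>2) /
                      sqrt (((a - \<alpha>)\<^sup>2 + \<beta>\<^sup>2) * ((b - \<alpha>)\<^sup>2 + \<beta>\<^sup>2))"

definition wave_B :: "real \<Rightarrow> real \<Rightarrow> real \<Rightarrow> real \<Rightarrow> real \<Rightarrow> real \<Rightarrow> real" where
  "wave_B a b \<delta> \<nu> \<kappa> x =
     a + (b - a) * (1 - jacobi_cn \<kappa> (\<nu> * x)) / (1 + \<delta> + (\<delta> - 1) * jacobi_cn \<kappa> (\<nu> * x))"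

definition lax_matrix :: "(real \<Rightarrow> real) \<Rightarrow> complex \<Rightarrow> real \<Rightarrow> complex^2^2" where
  "lax_matrix u l x = vector [vector [l, of_real (u x)], vector [- of_real (u x), - l]]"

definition lax_solution :: "(real \<Rightarrow> real) \<Rightarrow> complex \<Rightarrow> (real \<Rightarrow> complex^2) \<Rightarrow> bool" where
  "lax_solution u l \<phi> \<longleftrightarrow>
     (\<forall>x. (\<phi> has_vector_derivative (lax_matrix u l x *v \<phi> x)) (at x))"

text \<open>
  The number \<open>T\<close> is required to be a period of both the potential and the eigenfunction, but not the
  least one of either.
\<close>

definition periodic_eigenvalue :: "(real \<Rightarrow> real) \<Rightarrow> real \<Rightarrow> complex \<Rightarrow> bool" where
  "periodic_eigenvalue u T l \<longleftrightarrow>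
     0 < T \<and> periodic_fun_simple u T \<and>
     (\<exists>\<phi>. (\<exists>x. \<phi> x \<noteq> 0) \<and> lax_solution u l \<phi> \<and> periodic_fun_simple \<phi> T)"

definition fundamental_period :: "(real \<Rightarrow> 'a) \<Rightarrow> real \<Rightarrow> bool" where
  "fundamental_period u L \<longleftrightarrow>
     0 < L \<and> periodic_fun_simple u L \<and> (\<forall>T>0. periodic_fun_simple u T \<longrightarrow> L \<le> T)"

end

theory Submission
  imports Defs
begin

text \<open>
  For a travelling wave the symmetric square of the spectral problem has a solution that is
  polynomial in \<open>u\<close>, \<open>u'\<close> and \<open>\<lambda>\<close>. It has rank one precisely when \<open>\<lambda>\<close> is half the sum of two roots
  of the quartic, so it is then \<open>\<phi> \<phi>\<^sup>t\<close> for a solution \<open>\<phi>\<close> of the spectral problem, recovered by a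
  square root of a nowhere vanishing function. Since \<open>\<phi> \<phi>\<^sup>t\<close> has the period \<open>L\<close> of the wave, \<open>\<phi>\<close> is
  periodic or antiperiodic under \<open>L\<close>, hence always periodic under \<open>2 L\<close>. Whether it is periodic
  under \<open>L\<close> depends on the winding number of the closed curve \<open>u' + 2 \<i> \<phi>\<^sub>1 \<phi>\<^sub>2\<close> about the origin; it
  is zero if \<open>\<phi>\<^sub>1 \<phi>\<^sub>2\<close> is negative at all critical points of \<open>u\<close>.
\<close>

section \<open>Jacobi elliptic functions\<close>

text \<open>The choice of the square depends on how the roots are split into two pairs, since it
  must not vanish anywhere. For real \<open>l\<close> the component \<open>\<phi>\<^sub>1\<close>
  may have zeros, but the squares of \<open>\<phi>\<^sub>1 \<plusminus> \<i> \<phi>\<^sub>2\<close>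
  are safe: their product is \<open>S\<^sup>2 = v\<^sup>2 + 4 R\<^sup>2\<close>, a sum of real
  squares. For the two complex values of wave (B), \<open>S\<close> vanishes somewhere if
  \<open>\<alpha> = 0\<close>, and \<open>\<phi>\<^sub>1\<close> itself is used. The splitting also
  decides the period. If both turning values of the wave (\<open>u1\<close>, \<open>u2\<close> or
  \<open>a\<close>, \<open>b\<close>) belong to the same pair, then \<open>R\<close> is negative at
  both and \<open>L\<close> suffices. For the other two splittings in (A), \<open>R\<close> has
  opposite signs at \<open>u1\<close> and \<open>u2\<close>, and only \<open>2 L\<close> is claimed.
  The case distinction on \<open>e\<close> comes from \<open>e = - 4 l1 l2 l3\<close> in (A) and
  \<open>e = 4 l1 l2 l3\<close> in (B): the third pair collapses to 0 exactly when
  \<open>e = 0\<close>.\<close>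

lemma interval_integral_has_vector_derivative:
  fixes f :: "real \<Rightarrow> 'a::euclidean_space"
  assumes "continuous_on UNIV f"
  shows "((\<lambda>u. LBINT t=ereal a..ereal u. f t) has_vector_derivative f x) (at x)"
proof -
  \<comment> \<open>A compact interval around \<open>a\<close> with \<open>x\<close> in its
    interior, so that the derivative within the interval is a full one.\<close>
  define l where "l = min a x - 1"
  define h where "h = max a x + 1"
  have bnd: "l < x" "x < h" "l \<le> a" "a \<le> h"
    by (auto simp: l_def h_def)
  have "((\<lambda>u. LBINT t=ereal a..ereal u. f t) has_vector_derivative f x) (at x within {l..h})"
    by (rule interval_integral_FTC2) (use bnd continuous_on_subset[OF assms] in auto)
  then have "((\<lambda>u. LBINT t=ereal a..ereal u. f t) has_vector_derivative f x) (at x within {l<..<h})"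
    by (rule has_vector_derivative_within_subset) auto
  then show ?thesis
    by (subst (asm) has_vector_derivative_within_open) (use bnd in auto)
qed

locale jacobi_modulus =
  fixes \<kappa> :: real
  assumes modulus: "\<kappa>\<^sup>2 < 1"
begin

definition dn :: "real \<Rightarrow> real" where
  "dn x = sqrt (1 - \<kappa>\<^sup>2 * (jacobi_sn \<kappa> x)\<^sup>2)"

lemma radicand_pos: "0 < 1 - \<kappa>\<^sup>2 * (sin t)\<^sup>2"
proof -
  have "\<kappa>\<^sup>2 * (sin t)\<^sup>2 \<le> \<kappa>\<^sup>2 * 1"
    by (intro mult_left_mono) (auto simp: abs_square_le_1)
  then show ?thesis
    using modulus by simp
qed

lemma DERIV_ellipticF:
  "(ellipticF \<kappa> has_real_derivative 1 / sqrt (1 - \<kappa>\<^sup>2 * (sin \<phi>)\<^sup>2)) (at \<phi>)"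
proof -
  have "continuous_on UNIV (\<lambda>t. 1 / sqrt (1 - \<kappa>\<^sup>2 * (sin t)\<^sup>2))"
    using radicand_pos by (intro continuous_intros) (auto simp: less_imp_neq[symmetric])
  from interval_integral_has_vector_derivative[OF this, of 0 \<phi>] show ?thesis
    by (simp add: ellipticF_def[abs_def] has_real_derivative_iff_has_vector_derivative zero_ereal_def)
qed

lemma isCont_ellipticF: "isCont (ellipticF \<kappa>) \<phi>"
  using DERIV_ellipticF DERIV_isCont by blast

lemma ellipticF_0 [simp]: "ellipticF \<kappa> 0 = 0"
  by (simp add: ellipticF_def zero_ereal_def)

text \<open>The integrand is at least 1. This one estimate yields strict monotonicity and, with the
  intermediate value theorem, surjectivity, which make the amplitude a genuine inverse.\<close>

lemma ellipticF_growth: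
  assumes "\<phi> \<le> \<psi>"
  shows "\<psi> - \<phi> \<le> ellipticF \<kappa> \<psi> - ellipticF \<kappa> \<phi>"
proof -
  have "((\<lambda>t. ellipticF \<kappa> t - t) has_real_derivative 1 / sqrt (1 - \<kappa>\<^sup>2 * (sin t)\<^sup>2) - 1) (at t)" for t
    by (intro derivative_intros DERIV_ellipticF)
  moreover have "0 \<le> 1 / sqrt (1 - \<kappa>\<^sup>2 * (sin t)\<^sup>2) - 1" for t
    using radicand_pos[of t] by (simp add: field_simps)
  ultimately have "ellipticF \<kappa> \<phi> - \<phi> \<le> ellipticF \<kappa> \<psi> - \<psi>"
    using DERIV_nonneg_imp_nondecreasing[OF assms, of "\<lambda>t. ellipticF \<kappa> t - t"] by blast
  then show ?thesis
    by simp
qed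

lemma strict_mono_ellipticF: "strict_mono (ellipticF \<kappa>)"
proof (rule strict_monoI)
  fix x y :: real
  assume "x < y"
  then show "ellipticF \<kappa> x < ellipticF \<kappa> y"
    using ellipticF_growth[of x y] by linarith
qed

lemma ellipticF_eq_iff [simp]: "ellipticF \<kappa> \<phi> = ellipticF \<kappa> \<psi> \<longleftrightarrow> \<phi> = \<psi>"
  using strict_mono_ellipticF by (simp add: strict_mono_eq)

lemma ellipticF_surj: "\<exists>\<phi>. ellipticF \<kappa> \<phi> = x"
proof -
  have "ellipticF \<kappa> (- \<bar>x\<bar>) \<le> x" "x \<le> ellipticF \<kappa> \<bar>x\<bar>"
    using ellipticF_growth[of 0 "\<bar>x\<bar>"] ellipticF_growth[of "- \<bar>x\<bar>" 0] by auto
  then show ?thesis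
    using IVT[of "ellipticF \<kappa>" "- \<bar>x\<bar>" x "\<bar>x\<bar>"] isCont_ellipticF by auto
qed

lemma am_ellipticF [simp]: "jacobi_am \<kappa> (ellipticF \<kappa> \<phi>) = \<phi>"
  unfolding jacobi_am_def by (rule the_equality) auto

lemma ellipticF_am [simp]: "ellipticF \<kappa> (jacobi_am \<kappa> x) = x"
  using ellipticF_surj[of x] by auto

lemma am_0 [simp]: "jacobi_am \<kappa> 0 = 0"
  using am_ellipticF[of 0] by simp

lemma dn_pos: "0 < dn x"
  using radicand_pos by (simp add: dn_def jacobi_sn_def)

lemma dn_squared: "(dn x)\<^sup>2 = 1 - \<kappa>\<^sup>2 * (jacobi_sn \<kappa> x)\<^sup>2"
  using radicand_pos[of "jacobi_am \<kappa> x"] by (simp add: dn_def jacobi_sn_def)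

lemma DERIV_am: "(jacobi_am \<kappa> has_real_derivative dn x) (at x)"
proof -
  have "isCont (jacobi_am \<kappa>) (ellipticF \<kappa> (jacobi_am \<kappa> x))"
    by (rule isCont_inverse_function[of 1]) (auto intro: isCont_ellipticF)
  then have "(jacobi_am \<kappa> has_real_derivative inverse (1 / dn x)) (at x)"
    using dn_pos[of x] DERIV_ellipticF[of "jacobi_am \<kappa> x"]
    by (intro DERIV_inverse_function[of "ellipticF \<kappa>" _ _ _ "x - 1" "x + 1"])
       (auto simp: dn_def jacobi_sn_def)
  then show ?thesis
    by simp
qed

lemma DERIV_sn: "(jacobi_sn \<kappa> has_real_derivative jacobi_cn \<kappa> x * dn x) (at x)"
  unfolding jacobi_sn_def[abs_def] jacobi_cn_def
  by (auto intro!: derivative_eq_intros DERIV_am)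

lemma DERIV_cn: "(jacobi_cn \<kappa> has_real_derivative - jacobi_sn \<kappa> x * dn x) (at x)"
  unfolding jacobi_cn_def[abs_def] jacobi_sn_def
  by (auto intro!: derivative_eq_intros DERIV_am)

lemma DERIV_dn:
  "(dn has_real_derivative - \<kappa>\<^sup>2 * jacobi_sn \<kappa> x * jacobi_cn \<kappa> x) (at x)"
proof -
  have "1 - \<kappa>\<^sup>2 * (jacobi_sn \<kappa> x)\<^sup>2 > 0"
    using radicand_pos by (simp add: jacobi_sn_def)
  then show ?thesis
    unfolding dn_def[abs_def]
    by (auto intro!: derivative_eq_intros DERIV_sn simp: dn_def field_simps)
qed

lemma DERIV_sn_scaled:
  "((\<lambda>x. jacobi_sn \<kappa> (\<nu> * x)) has_real_derivative \<nu> * (jacobi_cn \<kappa> (\<nu> * x) * dn (\<nu> * x))) (at x)"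
  by (rule DERIV_cong[OF DERIV_chain2[OF DERIV_sn DERIV_cmult_Id]]) simp

lemma DERIV_cn_scaled:
  "((\<lambda>x. jacobi_cn \<kappa> (\<nu> * x)) has_real_derivative - \<nu> * (jacobi_sn \<kappa> (\<nu> * x) * dn (\<nu> * x))) (at x)"
  by (rule DERIV_cong[OF DERIV_chain2[OF DERIV_cn DERIV_cmult_Id]]) simp

lemma DERIV_dn_scaled:
  "((\<lambda>x. dn (\<nu> * x)) has_real_derivative - \<nu> * \<kappa>\<^sup>2 * (jacobi_sn \<kappa> (\<nu> * x) * jacobi_cn \<kappa> (\<nu> * x))) (at x)"
  by (rule DERIV_cong[OF DERIV_chain2[OF DERIV_dn DERIV_cmult_Id]]) simp

lemma sn_cn_squared: "(jacobi_sn \<kappa> x)\<^sup>2 + (jacobi_cn \<kappa> x)\<^sup>2 = 1"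
  by (simp add: jacobi_sn_def jacobi_cn_def)

text \<open>The integrand has period pi. The value \<open>ellipticF \<kappa> pi\<close> is 2 K, with
  K the complete elliptic integral: a half-period of sn and cn, hence a period of the square of sn.
  So wave (A) repeats after 2 K / \<nu> and wave (B) after 4 K / \<nu>.\<close>

lemma ellipticF_add_pi: "ellipticF \<kappa> (\<phi> + pi) = ellipticF \<kappa> \<phi> + ellipticF \<kappa> pi"
proof -
  have "((\<lambda>t. ellipticF \<kappa> (t + pi) - ellipticF \<kappa> t) has_real_derivative 0) (at t)" for t
  proof -
    have "((\<lambda>t. ellipticF \<kappa> (t + pi)) has_real_derivative 1 / sqrt (1 - \<kappa>\<^sup>2 * (sin t)\<^sup>2)) (at t)"
      using DERIV_ellipticF[of "t + pi"] by (simp add: DERIV_shift)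
    from DERIV_diff[OF this DERIV_ellipticF[of t]] show ?thesis
      by simp
  qed
  then have "ellipticF \<kappa> (\<phi> + pi) - ellipticF \<kappa> \<phi> = ellipticF \<kappa> (0 + pi) - ellipticF \<kappa> 0"
    using DERIV_isconst_all[of "\<lambda>t. ellipticF \<kappa> (t + pi) - ellipticF \<kappa> t"] by blast
  then show ?thesis
    by simp
qed

lemma ellipticF_pi_pos: "0 < ellipticF \<kappa> pi"
  using strict_mono_less[OF strict_mono_ellipticF, of 0 pi] by simp

lemma ellipticF_of_nat_pi: "ellipticF \<kappa> (of_nat n * pi) = of_nat n * ellipticF \<kappa> pi"
proof (induction n)
  case (Suc n)
  then show ?case
    using ellipticF_add_pi[of "of_nat n * pi"] by (simp add: algebra_simps)
qed simp

lemma am_add_half_period: "jacobi_am \<kappa> (x + ellipticF \<kappa> pi) = jacobi_am \<kappa> x + pi"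
  using am_ellipticF[of "jacobi_am \<kappa> x + pi"] ellipticF_add_pi[of "jacobi_am \<kappa> x"] by simp

lemma sn_add_half_period: "jacobi_sn \<kappa> (x + ellipticF \<kappa> pi) = - jacobi_sn \<kappa> x"
  by (simp add: jacobi_sn_def am_add_half_period)

lemma cn_add_half_period: "jacobi_cn \<kappa> (x + ellipticF \<kappa> pi) = - jacobi_cn \<kappa> x"
  by (simp add: jacobi_cn_def am_add_half_period)

lemma am_pos: "0 < x \<Longrightarrow> 0 < jacobi_am \<kappa> x"
  using strict_mono_less[OF strict_mono_ellipticF, of 0 "jacobi_am \<kappa> x"] by simp

text \<open>Serves minimality of the period of wave (A), whose starting value \<open>u1\<close>
  recurs only at zeros of sn.\<close>

lemma sn_eq_0_imp_ge:
  assumes "0 < x" "jacobi_sn \<kappa> x = 0"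
  shows "ellipticF \<kappa> pi \<le> x"
proof -
  have "pi \<le> jacobi_am \<kappa> x"
    using assms am_pos[of x] sin_gt_zero[of "jacobi_am \<kappa> x"] by (fastforce simp: jacobi_sn_def)
  then show ?thesis
    using strict_mono_less_eq[OF strict_mono_ellipticF, of pi "jacobi_am \<kappa> x"] by simp
qed

lemma cn_eq_1_imp_ge:
  assumes "0 < x" "jacobi_cn \<kappa> x = 1"
  shows "2 * ellipticF \<kappa> pi \<le> x"
proof -
  obtain n :: int where n: "jacobi_am \<kappa> x = of_int n * 2 * pi"
    using assms(2) by (auto simp: jacobi_cn_def cos_one_2pi_int)
  then have "0 < n"
    using am_pos[OF assms(1)] by (simp add: zero_less_mult_iff)
  then have "real_of_int 1 * 2 * pi \<le> jacobi_am \<kappa> x"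
    unfolding n by (intro mult_right_mono) auto
  then have "of_nat 2 * pi \<le> jacobi_am \<kappa> x"
    by simp
  then show ?thesis
    using strict_mono_less_eq[OF strict_mono_ellipticF, of "of_nat 2 * pi" "jacobi_am \<kappa> x"]
    unfolding ellipticF_of_nat_pi by simp
qed

end

section \<open>Square roots along the real line\<close>

lemma has_vector_derivative_zero_imp_const:
  fixes f :: "real \<Rightarrow> 'a::real_normed_vector"
  assumes "\<And>x. (f has_vector_derivative 0) (at x)"
  shows "f x = f y"
  using has_vector_derivative_zero_constant[of UNIV f] assms by (metis UNIV_I convex_UNIV)

lemma has_vector_derivative_shift:
  fixes f :: "real \<Rightarrow> 'a::real_normed_vector"
  assumes "(f has_vector_derivative D) (at (x + L))"
  shows "((\<lambda>x. f (x + L)) has_vector_derivative D) (at x)"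
  using vector_diff_chain_at[of "\<lambda>x. x + L" 1 x f D] assms
  by (force simp: o_def intro!: derivative_eq_intros)

lemma has_vector_derivative_quotient:
  fixes f g :: "real \<Rightarrow> 'a::real_normed_field"
  assumes "(f has_vector_derivative f') (at x)" "(g has_vector_derivative g') (at x)" "g x \<noteq> 0"
  shows "((\<lambda>x. f x / g x) has_vector_derivative (f' * g x - f x * g') / (g x * g x)) (at x)"
  using has_derivative_divide'[OF assms(1,2)[unfolded has_vector_derivative_def] assms(3)]
  by (simp add: has_vector_derivative_def scaleR_conv_of_real right_diff_distrib mult_ac)

text \<open>The root is continued as \<open>csqrt (F 0)\<close> times the exponential of half the
  integrated logarithmic derivative, so no branch cut interferes. The shift of \<open>f\<close> by
  \<open>L\<close> solves the same first-order linear equation as \<open>f\<close>, so their ratio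
  is a constant; its square is 1, and two shifts restore \<open>f\<close>.\<close>

lemma periodic_sqrt_exists:
  fixes F F' :: "real \<Rightarrow> complex"
  assumes deriv: "\<And>x. (F has_vector_derivative F' x) (at x)"
    and cont: "continuous_on UNIV F'"
    and nz: "\<And>x. F x \<noteq> 0"
    and per: "\<And>x. F (x + L) = F x"
  obtains f where "\<And>x. (f x)\<^sup>2 = F x" "\<And>x. (f has_vector_derivative F' x / (2 * f x)) (at x)"
    "\<And>x. f (x + 2 * L) = f x"
proof -
  define w where "w x = F' x / (2 * F x)" for x
  define a where "a x = (LBINT t=ereal 0..ereal x. w t)" for x
  define f where "f x = csqrt (F 0) * exp (a x)" for x
  have F_isCont: "isCont F x" for x
    using deriv has_vector_derivative_continuous by blast
  have a_deriv: "(a has_vector_derivative w x) (at x)" for x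
    unfolding a_def[abs_def] w_def[abs_def]
    by (rule interval_integral_has_vector_derivative)
       (use cont nz F_isCont in \<open>auto intro!: continuous_intros simp: continuous_on_eq_continuous_at\<close>)
  have exp_deriv: "((\<lambda>x. exp (k * a x)) has_vector_derivative k * w x * exp (k * a x)) (at x)" for k x
    using field_vector_diff_chain_at[OF a_deriv, of "\<lambda>z. exp (k * z)" "k * exp (k * a x)" x]
    by (force simp: o_def ac_simps intro!: derivative_eq_intros)
  have F_eq: "F x = F 0 * exp (2 * a x)" for x
  proof -
    have "((\<lambda>x. F x * exp (- 2 * a x)) has_vector_derivative
        F x * (- 2 * w x * exp (- 2 * a x)) + F' x * exp (- 2 * a x)) (at x)" for x
      by (intro has_vector_derivative_mult deriv exp_deriv)
    moreover have "F x * (- 2 * w x * exp (- 2 * a x)) + F' x * exp (- 2 * a x) = 0" for x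
      using nz[of x] by (simp add: w_def)
    ultimately have "F x * exp (- 2 * a x) = F 0 * exp (- 2 * a 0)"
      using has_vector_derivative_zero_imp_const[of "\<lambda>x. F x * exp (- 2 * a x)"] by metis
    moreover have "a 0 = 0"
      by (simp add: a_def zero_ereal_def)
    ultimately show ?thesis
      by (simp add: exp_minus field_simps)
  qed
  have sq: "(f x)\<^sup>2 = F x" for x
    by (simp add: f_def F_eq[of x] power_mult_distrib flip: exp_double)
  have f_nz: "f x \<noteq> 0" for x
    using nz[of x] sq[of x] by auto
  have f_deriv: "(f has_vector_derivative w x * f x) (at x)" for x
  proof -
    have "((\<lambda>x. csqrt (F 0) * exp (1 * a x)) has_vector_derivative
        csqrt (F 0) * (1 * w x * exp (1 * a x))) (at x)"
      by (intro has_vector_derivative_mult_right exp_deriv)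
    then show ?thesis
      by (simp add: f_def[abs_def] ac_simps)
  qed
  have F'_per: "F' (x + L) = F' x" for x
  proof (rule vector_derivative_unique_at)
    show "((\<lambda>x. F (x + L)) has_vector_derivative F' (x + L)) (at x)"
      using deriv by (rule has_vector_derivative_shift)
    show "((\<lambda>x. F (x + L)) has_vector_derivative F' x) (at x)"
      using deriv per by simp
  qed
  have ratio: "f (x + L) = f L / f 0 * f x" for x
  proof -
    have "((\<lambda>x. f (x + L)) has_vector_derivative w x * f (x + L)) (at x)" for x
      using has_vector_derivative_shift[OF f_deriv[of "x + L"]] by (simp add: w_def F'_per per)
    from has_vector_derivative_quotient[OF this f_deriv f_nz]
    have "((\<lambda>x. f (x + L) / f x) has_vector_derivative 0) (at x)" for x
      using f_nz[of x] by (simp add: field_simps)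
    then have "f (x + L) / f x = f (0 + L) / f 0"
      by (rule has_vector_derivative_zero_imp_const)
    then show ?thesis
      using f_nz[of x] by (simp add: field_simps)
  qed
  have "(f L)\<^sup>2 = (f 0)\<^sup>2"
    using per[of 0] by (simp add: sq)
  then have "(f L / f 0)\<^sup>2 = 1"
    using f_nz[of 0] by (simp add: power_divide)
  then have "f (x + 2 * L) = f x" for x
    using ratio[of "x + L"] ratio[of x] by (simp add: power2_eq_square add.assoc flip: mult.assoc)
  moreover have "(f has_vector_derivative F' x / (2 * f x)) (at x)" for x
    using f_deriv[of x] f_nz[of x] by (simp add: w_def flip: sq) (simp add: power2_eq_square)
  ultimately show ?thesis
    using that sq by blast
qed

text \<open>The principal root depends on the value of \<open>F\<close> alone and therefore inherits
  every period of \<open>F\<close>; this is how a sign change over one period is excluded.\<close>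

lemma has_vector_derivative_csqrt:
  assumes "(F has_vector_derivative F') (at x)" "F x \<notin> \<real>\<^sub>\<le>\<^sub>0"
  shows "((\<lambda>x. csqrt (F x)) has_vector_derivative F' / (2 * csqrt (F x))) (at x)"
  using field_vector_diff_chain_at[OF assms(1) has_field_derivative_csqrt[OF assms(2)]]
  by (simp add: o_def field_simps)

text \<open>
  Here \<open>(F, R, G)\<close> stands for \<open>(f\<^sup>2, f g, g\<^sup>2)\<close>; its equations are the symmetric square of the
  trace-free system for \<open>(f, g)\<close>.
\<close>
lemma linear_system_from_square:
  fixes F R G f :: "real \<Rightarrow> complex"
  assumes F: "(F has_vector_derivative 2 * p * F x + 2 * q * R x) (at x)"
    and R: "(R has_vector_derivative r * F x + q * G x) (at x)"
    and rank1: "F x * G x = (R x)\<^sup>2"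
    and f: "(f x)\<^sup>2 = F x" "F x \<noteq> 0"
    and f': "(f has_vector_derivative (2 * p * F x + 2 * q * R x) / (2 * f x)) (at x)"
  shows "(f has_vector_derivative p * f x + q * (R x / f x)) (at x)"
    and "((\<lambda>x. R x / f x) has_vector_derivative r * f x - p * (R x / f x)) (at x)"
proof -
  have nz: "f x \<noteq> 0"
    using f by auto
  then have eq: "(2 * p * F x + 2 * q * R x) / (2 * f x) = p * f x + q * (R x / f x)"
    by (simp add: f(1)[symmetric] field_simps power2_eq_square)
  then show f_deriv: "(f has_vector_derivative p * f x + q * (R x / f x)) (at x)"
    using f' by simp
  have G: "G x = (R x / f x)\<^sup>2"
    using rank1 nz by (simp add: f(1)[symmetric] field_simps)
  have "((r * F x + q * G x) * f x - R x * (p * f x + q * (R x / f x))) / (f x * f x)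
      = r * f x - p * (R x / f x)"
    using nz unfolding G by (simp add: f(1)[symmetric] field_simps power2_eq_square)
  with has_vector_derivative_quotient[OF R f_deriv nz]
  show "((\<lambda>x. R x / f x) has_vector_derivative r * f x - p * (R x / f x)) (at x)"
    by simp
qed

section \<open>Periodic eigenvalues from scalar components\<close>

lemma has_vector_derivative_vector_2:
  fixes f g :: "real \<Rightarrow> complex"
  assumes "(f has_vector_derivative f') (at x)" "(g has_vector_derivative g') (at x)"
  shows "((\<lambda>x. vector [f x, g x] :: complex^2) has_vector_derivative vector [f', g']) (at x)"
proof -
  have lin: "bounded_linear (\<lambda>z::complex. axis i z :: complex^2)" for i
    by (auto intro!: linear_conv_bounded_linear[THEN iffD1] linearI simp: axis_def vec_eq_iff)
  have split: "vector [y, z] = axis 1 y + (axis 2 z :: complex^2)" for y z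
    by (simp add: vec_eq_iff forall_2 axis_def)
  show ?thesis
    unfolding split
    by (intro has_vector_derivative_add bounded_linear.has_vector_derivative[OF lin] assms)
qed

lemma periodic_eigenvalueI:
  assumes "0 < T" "\<And>x. u (x + T) = u x"
    and f: "\<And>x. (f has_vector_derivative l * f x + of_real (u x) * g x) (at x)"
    and g: "\<And>x. (g has_vector_derivative - of_real (u x) * f x - l * g x) (at x)"
    and per: "\<And>x. f (x + T) = f x" "\<And>x. g (x + T) = g x"
    and nz: "f y \<noteq> 0 \<or> g y \<noteq> 0"
  shows "periodic_eigenvalue u T l"
  unfolding periodic_eigenvalue_def
proof (intro conjI exI)
  let ?\<phi> = "\<lambda>x. vector [f x, g x] :: complex^2"
  show "periodic_fun_simple u T" "periodic_fun_simple ?\<phi> T"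
    using assms by (simp_all add: periodic_fun_simple_def)
  show "?\<phi> y \<noteq> 0"
    using nz by (auto simp: vec_eq_iff forall_2)
  have "lax_matrix u l x *v ?\<phi> x =
      vector [l * f x + of_real (u x) * g x, - of_real (u x) * f x - l * g x]" for x
    by (simp add: vec_eq_iff forall_2 lax_matrix_def matrix_vector_mult_def sum_2)
  then show "lax_solution u l ?\<phi>"
    unfolding lax_solution_def
    using has_vector_derivative_vector_2[OF f g] by simp
qed fact

text \<open>The rotation of \<open>(\<phi>\<^sub>1, \<phi>\<^sub>2)\<close> into
  \<open>(\<phi>\<^sub>2, - \<phi>\<^sub>1)\<close> commutes with the part of the matrix containing
  \<open>u\<close> and anticommutes with its diagonal part.\<close>

lemma periodic_eigenvalue_uminus:
  assumes "periodic_eigenvalue u T l"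
  shows "periodic_eigenvalue u T (- l)"
proof -
  from assms obtain \<phi> where T: "0 < T" "periodic_fun_simple u T"
    and \<phi>: "\<exists>x. \<phi> x \<noteq> 0" "lax_solution u l \<phi>" "periodic_fun_simple \<phi> T"
    by (auto simp: periodic_eigenvalue_def)
  obtain y where "\<phi> y \<noteq> 0"
    using \<phi>(1) by blast
  then have nz: "\<phi> y $ 2 \<noteq> 0 \<or> - \<phi> y $ 1 \<noteq> 0"
    by (auto simp: vec_eq_iff forall_2)
  have nth: "((\<lambda>x. \<phi> x $ i) has_vector_derivative (lax_matrix u l x *v \<phi> x) $ i) (at x)" for i x
    using \<phi>(2) by (intro bounded_linear.has_vector_derivative[OF bounded_linear_vec_nth])
      (simp add: lax_solution_def)
  have comp: "((\<lambda>x. \<phi> x $ 1) has_vector_derivative l * \<phi> x $ 1 + of_real (u x) * \<phi> x $ 2) (at x)"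
    "((\<lambda>x. \<phi> x $ 2) has_vector_derivative - of_real (u x) * \<phi> x $ 1 - l * \<phi> x $ 2) (at x)" for x
    using nth[of 1 x] nth[of 2 x]
    by (simp_all add: lax_matrix_def matrix_vector_mult_def sum_2)
  show ?thesis
  proof (rule periodic_eigenvalueI[where f = "\<lambda>x. \<phi> x $ 2" and g = "\<lambda>x. - \<phi> x $ 1" and y = y])
    show "((\<lambda>x. \<phi> x $ 2) has_vector_derivative - l * \<phi> x $ 2 + of_real (u x) * - \<phi> x $ 1) (at x)" for x
      by (rule comp(2)[of x, THEN has_vector_derivative_eq_rhs]) simp
    show "((\<lambda>x. - \<phi> x $ 1) has_vector_derivative - of_real (u x) * \<phi> x $ 2 - - l * - \<phi> x $ 1) (at x)" for x
      by (rule comp(1)[of x, THEN has_vector_derivative_minus, THEN has_vector_derivative_eq_rhs]) simp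
  qed (use T \<phi>(3) nz in \<open>auto simp: periodic_fun_simple_def\<close>)
qed

section \<open>Eigenfunctions over a travelling wave\<close>

text \<open>Both equations are assumed because differentiating \<open>energy\<close> gives
  \<open>DERIV_v\<close> only where \<open>v\<close> does not vanish. \<open>L\<close> is any
  positive period; minimality is shown separately for each wave.\<close>

locale mkdv_wave =
  fixes u v :: "real \<Rightarrow> real" and c d e L :: real
  assumes DERIV_u: "(u has_real_derivative v x) (at x)"
    and DERIV_v: "(v has_real_derivative e + c * u x - 2 * (u x) ^ 3) (at x)"
    and energy: "(v x)\<^sup>2 = 2 * e * u x - (u x) ^ 4 + c * (u x)\<^sup>2 - d"
    and period_pos: "0 < L"
    and periodic: "u (x + L) = u x"
begin

lemma v_periodic: "v (x + L) = v x"
proof (rule DERIV_unique)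
  show "(u has_real_derivative v x) (at x)"
    by (rule DERIV_u)
  show "(u has_real_derivative v (x + L)) (at x)"
    using DERIV_u[of "x + L"] unfolding DERIV_shift by (simp add: periodic)
qed

lemma u_vector_deriv: "((\<lambda>x. complex_of_real (u x)) has_vector_derivative of_real (v x)) (at x)"
  using DERIV_u by (rule has_vector_derivative_of_real)

end

text \<open>
  The symmetric square of the spectral problem has a solution built from \<open>u\<close> and \<open>v = u'\<close>: with
  \<open>S = 2 l u + m\<close> and \<open>R = k - u\<^sup>2 / 2\<close> it reads \<open>\<phi>\<^sub>1\<^sup>2 + \<phi>\<^sub>2\<^sup>2 = S\<close>, \<open>\<phi>\<^sub>1\<^sup>2 - \<phi>\<^sub>2\<^sup>2 = v\<close>,
  \<open>\<phi>\<^sub>1 \<phi>\<^sub>2 = R\<close>. It has rank one exactly when the quartic factors as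
  \<open>(u\<^sup>2 - 2 k - S) (u\<^sup>2 - 2 k + S)\<close>.
\<close>
locale mkdv_factorization = mkdv_wave +
  fixes l k m :: complex
  assumes c_eq: "of_real c = 4 * l\<^sup>2 + 4 * k"
    and e_eq: "of_real e = 2 * l * m"
    and d_eq: "of_real d = 4 * k\<^sup>2 - m\<^sup>2"
begin

definition S :: "real \<Rightarrow> complex" where
  "S x = 2 * l * of_real (u x) + m"

definition R :: "real \<Rightarrow> complex" where
  "R x = k - (of_real (u x))\<^sup>2 / 2"

abbreviation D :: "real \<Rightarrow> complex" where
  "D x \<equiv> of_real (v x)"

lemma S_deriv: "(S has_vector_derivative 2 * l * D x) (at x)"
  unfolding S_def[abs_def] by (auto intro!: derivative_eq_intros DERIV_u)

lemma R_deriv: "(R has_vector_derivative - of_real (u x) * D x) (at x)"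
  unfolding R_def[abs_def] power2_eq_square
  by (rule derivative_eq_intros u_vector_deriv refl)+ simp

lemma D_deriv: "(D has_vector_derivative 2 * l * S x + 4 * of_real (u x) * R x) (at x)"
proof -
  have "(D has_vector_derivative of_real (e + c * u x - 2 * (u x) ^ 3)) (at x)"
    using DERIV_v by (rule has_vector_derivative_of_real)
  also have "of_real (e + c * u x - 2 * (u x) ^ 3) = 2 * l * S x + 4 * of_real (u x) * R x"
    by (simp add: c_eq e_eq S_def R_def algebra_simps power2_eq_square power3_eq_cube)
  finally show ?thesis .
qed

lemma S_squared: "(S x)\<^sup>2 = (D x)\<^sup>2 + 4 * (R x)\<^sup>2"
proof -
  have "(D x)\<^sup>2 = of_real ((v x)\<^sup>2)"
    by simp
  also have "\<dots> = 2 * of_real e * of_real (u x) - of_real (u x) ^ 4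
      + of_real c * (of_real (u x))\<^sup>2 - of_real d"
    unfolding energy by simp
  finally have "(D x)\<^sup>2 = (S x)\<^sup>2 - (2 * k - (of_real (u x))\<^sup>2)\<^sup>2"
    unfolding S_def c_eq d_eq e_eq by (simp add: algebra_simps power2_eq_square power4_eq_xxxx)
  moreover have "4 * (R x)\<^sup>2 = (2 * R x)\<^sup>2"
    by (simp add: power_mult_distrib)
  moreover have "2 * R x = 2 * k - (of_real (u x))\<^sup>2"
    by (simp add: R_def)
  ultimately show ?thesis
    by simp
qed

lemma S_periodic: "S (x + L) = S x" and R_periodic: "R (x + L) = R x"
  by (simp_all add: S_def R_def periodic)

lemma isCont_S: "isCont S x" and isCont_R: "isCont R x" and isCont_D: "isCont D x"
  and isCont_u: "isCont (\<lambda>x. complex_of_real (u x)) x"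
  using S_deriv R_deriv D_deriv u_vector_deriv has_vector_derivative_continuous by blast+

text \<open>Since \<open>S + D\<close> is \<open>2 \<phi>\<^sub>1\<^sup>2\<close>, the first
  component is a square root of it up to a constant, and the second follows on dividing
  \<open>\<phi>\<^sub>1 \<phi>\<^sub>2\<close> by it. This serves the complex eigenvalues of wave
  (B).\<close>

lemma periodic_eigenvalue_from_component:
  assumes nz: "\<And>x. S x + D x \<noteq> 0"
  shows "periodic_eigenvalue u (2 * L) l"
proof -
  let ?F = "\<lambda>x. S x + D x" and ?F' = "\<lambda>x. 2 * l * (S x + D x) + 2 * of_real (u x) * (2 * R x)"
  have F': "(?F has_vector_derivative ?F' x) (at x)" for x
    by (rule has_vector_derivative_eq_rhs[OF has_vector_derivative_add[OF S_deriv D_deriv]])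
       (simp add: algebra_simps)
  have R': "((\<lambda>x. 2 * R x) has_vector_derivative
      - of_real (u x) * (S x + D x) + of_real (u x) * (S x - D x)) (at x)" for x
    by (rule has_vector_derivative_eq_rhs[OF has_vector_derivative_mult_right[OF R_deriv]])
       (simp add: algebra_simps)
  have rank1: "(S x + D x) * (S x - D x) = (2 * R x)\<^sup>2" for x
    using S_squared[of x] by (simp add: algebra_simps power2_eq_square)
  obtain f where f: "\<And>x. (f x)\<^sup>2 = ?F x"
    "\<And>x. (f has_vector_derivative ?F' x / (2 * f x)) (at x)" "\<And>x. f (x + 2 * L) = f x"
  proof (rule periodic_sqrt_exists[OF F'])
    show "continuous_on UNIV ?F'"
      by (auto simp: continuous_on_eq_continuous_at
          intro!: continuous_intros isCont_S isCont_R isCont_D isCont_u)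
  qed (use nz in \<open>auto simp: S_periodic v_periodic\<close>)
  have "(f has_vector_derivative l * f x + of_real (u x) * (2 * R x / f x)) (at x)"
    "((\<lambda>x. 2 * R x / f x) has_vector_derivative - of_real (u x) * f x - l * (2 * R x / f x)) (at x)" for x
    by (rule linear_system_from_square[where R = "\<lambda>x. 2 * R x", OF F' R' rank1 f(1) nz f(2)])+
  note sol = this
  show ?thesis
  proof (rule periodic_eigenvalueI[where f = f and g = "\<lambda>x. 2 * R x / f x" and y = 0])
    show "u (x + 2 * L) = u x" "f (x + 2 * L) = f x"
        "2 * R (x + 2 * L) / f (x + 2 * L) = 2 * R x / f x" for x
      using periodic[of "x + L"] R_periodic[of "x + L"] f(3)
      by (simp_all add: periodic R_periodic add.assoc)
    show "f 0 \<noteq> 0 \<or> 2 * R 0 / f 0 \<noteq> 0"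
      using nz[of 0] f(1)[of 0] by auto
  qed (use period_pos sol in simp_all)
qed

text \<open>
  The combinations \<open>\<phi>\<^sub>1 \<plusminus> \<i> \<phi>\<^sub>2\<close> have squares \<open>D \<plusminus> 2 \<i> R\<close> and product \<open>S\<close>, so they never vanish when
  \<open>S\<close> does not. The factor \<open>w\<close> leaves room to rotate the square away from a branch cut.
\<close>
lemma periodic_eigenvalue_from_sqrt:
  assumes f: "\<And>x. (f x)\<^sup>2 = w * (D x + 2 * \<i> * R x)"
    and f': "\<And>x. (f has_vector_derivative
      w * (2 * l * S x + 4 * of_real (u x) * R x - 2 * \<i> * of_real (u x) * D x) / (2 * f x)) (at x)"
    and f_per: "\<And>x. f (x + T) = f x"
    and nz: "\<And>x. S x \<noteq> 0" "w \<noteq> 0"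
    and T: "0 < T" "\<And>x. u (x + T) = u x"
  shows "periodic_eigenvalue u T l"
proof -
  let ?F = "\<lambda>x. w * (D x + 2 * \<i> * R x)" and ?G = "\<lambda>x. w * (D x - 2 * \<i> * R x)"
  have prod: "?F x * ?G x = (w * S x)\<^sup>2" for x
    by (simp add: power_mult_distrib S_squared) (simp add: algebra_simps power2_eq_square)
  then have F_nz: "?F x \<noteq> 0" for x
    using nz by (metis mult_eq_0_iff power_not_zero)
  have f_nz: "f x \<noteq> 0" for x
    using f[of x] F_nz[of x] by auto
  have F'_eq: "w * (2 * l * S x + 4 * of_real (u x) * R x - 2 * \<i> * of_real (u x) * D x)
      = 2 * (- \<i> * of_real (u x)) * ?F x + 2 * l * (w * S x)" for x
    by (simp add: algebra_simps)
  have F': "(?F has_vector_derivative 2 * (- \<i> * of_real (u x)) * ?F x + 2 * l * (w * S x)) (at x)" for x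
    by (rule has_vector_derivative_eq_rhs[OF has_vector_derivative_mult_right[OF
            has_vector_derivative_add[OF D_deriv has_vector_derivative_mult_right[OF R_deriv]]]])
       (simp add: algebra_simps)
  have S': "((\<lambda>x. w * S x) has_vector_derivative l * ?F x + l * ?G x) (at x)" for x
    by (rule has_vector_derivative_eq_rhs[OF has_vector_derivative_mult_right[OF S_deriv]])
       (simp add: algebra_simps)
  \<comment> \<open>Up to the common factor of a square root of \<open>w\<close>, \<open>f\<close>
    is \<open>\<phi>\<^sub>1 + \<i> \<phi>\<^sub>2\<close>. As \<open>f g = w S\<close>,
    \<open>g\<close> is then \<open>\<phi>\<^sub>1 - \<i> \<phi>\<^sub>2\<close> up to the same
    factor; the end of the proof inverts this change of basis.\<close>
  define g where "g x = w * S x / f x" for x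
  have f_sol: "(f has_vector_derivative - \<i> * of_real (u x) * f x + l * g x) (at x)"
    and g_sol: "(g has_vector_derivative l * f x - (- \<i> * of_real (u x)) * g x) (at x)" for x
    unfolding g_def[abs_def]
    by (rule linear_system_from_square[where R = "\<lambda>x. w * S x", OF F' S' prod f F_nz
          f'[unfolded F'_eq]])+
  show ?thesis
  proof (rule periodic_eigenvalueI[where f = "\<lambda>x. f x + g x" and g = "\<lambda>x. - \<i> * (f x - g x)" and y = 0])
    show "((\<lambda>x. f x + g x) has_vector_derivative
        l * (f x + g x) + of_real (u x) * (- \<i> * (f x - g x))) (at x)" for x
      by (rule has_vector_derivative_eq_rhs[OF has_vector_derivative_add[OF f_sol g_sol]])
         (simp add: algebra_simps)
    show "((\<lambda>x. - \<i> * (f x - g x)) has_vector_derivative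
        - of_real (u x) * (f x + g x) - l * (- \<i> * (f x - g x))) (at x)" for x
      by (rule has_vector_derivative_eq_rhs[OF has_vector_derivative_mult_right[OF
              has_vector_derivative_diff[OF f_sol g_sol]]])
         (simp add: algebra_simps)
    show "f 0 + g 0 \<noteq> 0 \<or> - \<i> * (f 0 - g 0) \<noteq> 0"
      using f_nz[of 0] by auto
  qed (use T f_per in \<open>simp_all add: g_def S_def\<close>)
qed

end

locale mkdv_real_factorization = mkdv_wave +
  fixes l k m :: real
  assumes c_eq: "c = 4 * l\<^sup>2 + 4 * k"
    and e_eq: "e = 2 * l * m"
    and d_eq: "d = 4 * k\<^sup>2 - m\<^sup>2"
begin

sublocale mkdv_factorization u v c d e L "of_real l" "of_real k" "of_real m"
  by unfold_locales (simp_all add: c_eq d_eq e_eq)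

lemma R_real: "R x = of_real (k - (u x)\<^sup>2 / 2)"
  by (simp add: R_def)

text \<open>For real \<open>l\<close>, \<open>k\<close>, \<open>m\<close> the relation
  \<open>S\<^sup>2 = D\<^sup>2 + 4 R\<^sup>2\<close> is a sum of real squares, so a zero of
  \<open>S\<close> would be a critical point of \<open>u\<close> at which \<open>R\<close> vanishes
  too.\<close>

lemma S_nonzero:
  assumes "v x = 0 \<Longrightarrow> (u x)\<^sup>2 / 2 \<noteq> k"
  shows "S x \<noteq> 0"
proof
  assume "S x = 0"
  then have "complex_of_real ((v x)\<^sup>2 + 4 * (k - (u x)\<^sup>2 / 2)\<^sup>2) = 0"
    using S_squared[of x] by (simp add: R_real)
  then have "(v x)\<^sup>2 + 4 * (k - (u x)\<^sup>2 / 2)\<^sup>2 = 0"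
    unfolding of_real_eq_0_iff .
  then have "v x = 0" "k - (u x)\<^sup>2 / 2 = 0"
    by (simp_all add: add_nonneg_eq_0_iff)
  then show False
    using assms by simp
qed

lemma periodic_eigenvalue_double_period:
  assumes "\<And>x. v x = 0 \<Longrightarrow> (u x)\<^sup>2 / 2 \<noteq> k"
  shows "periodic_eigenvalue u (2 * L) (of_real l)"
proof -
  have nz: "S x \<noteq> 0" for x
    using S_nonzero assms by blast
  let ?F = "\<lambda>x. 1 * (D x + 2 * \<i> * R x)"
    and ?F' = "\<lambda>x. 1 * (2 * of_real l * S x + 4 * of_real (u x) * R x - 2 * \<i> * of_real (u x) * D x)"
  have F': "(?F has_vector_derivative ?F' x) (at x)" for x
    by (rule has_vector_derivative_eq_rhs[OF has_vector_derivative_mult_right[OF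
            has_vector_derivative_add[OF D_deriv has_vector_derivative_mult_right[OF R_deriv]]]])
       (simp add: algebra_simps)
  have "?F x * (D x - 2 * \<i> * R x) = (S x)\<^sup>2" for x
    by (simp add: S_squared) (simp add: algebra_simps power2_eq_square)
  then have F_nz: "?F x \<noteq> 0" for x
    using nz by (metis mult_eq_0_iff power_not_zero)
  obtain f where f: "\<And>x. (f x)\<^sup>2 = ?F x"
    "\<And>x. (f has_vector_derivative ?F' x / (2 * f x)) (at x)" "\<And>x. f (x + 2 * L) = f x"
  proof (rule periodic_sqrt_exists[OF F'])
    show "continuous_on UNIV ?F'"
      by (auto simp: continuous_on_eq_continuous_at
          intro!: continuous_intros isCont_S isCont_R isCont_D isCont_u)
  qed (use F_nz in \<open>auto simp: R_periodic v_periodic\<close>)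
  show ?thesis
    by (rule periodic_eigenvalue_from_sqrt[OF f nz])
       (use period_pos periodic[of "x + L" for x] in \<open>simp_all add: periodic add.assoc\<close>)
qed

text \<open>
  Under this hypothesis \<open>D + 2 \<i> R\<close> stays off the closed positive imaginary axis, so its loop does
  not wind around the origin.
\<close>
lemma periodic_eigenvalue_single_period:
  assumes neg: "\<And>x. v x = 0 \<Longrightarrow> k < (u x)\<^sup>2 / 2"
  shows "periodic_eigenvalue u L (of_real l)"
proof -
  have nz: "S x \<noteq> 0" for x
    using S_nonzero neg by force
  let ?F = "\<lambda>x. \<i> * (D x + 2 * \<i> * R x)"
    and ?F' = "\<lambda>x. \<i> * (2 * of_real l * S x + 4 * of_real (u x) * R x - 2 * \<i> * of_real (u x) * D x)"
  have F': "(?F has_vector_derivative ?F' x) (at x)" for x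
    by (rule has_vector_derivative_eq_rhs[OF has_vector_derivative_mult_right[OF
            has_vector_derivative_add[OF D_deriv has_vector_derivative_mult_right[OF R_deriv]]]])
       (simp add: algebra_simps)
  \<comment> \<open>The real part of \<open>?F x\<close> is \<open>- 2 R\<close> and its imaginary
    part is \<open>v\<close>. It could be a nonpositive real only at a critical point with
    \<open>R \<ge> 0\<close>.\<close>
  have "?F x \<notin> \<real>\<^sub>\<le>\<^sub>0" for x
    using neg[of x] by (auto simp: R_real complex_nonpos_Reals_iff)
  note f' = has_vector_derivative_csqrt[OF F' this]
  show ?thesis
    by (rule periodic_eigenvalue_from_sqrt[OF _ f' _ nz])
       (use period_pos in \<open>simp_all add: periodic R_periodic v_periodic\<close>)
qed

end

section \<open>The wave with four real roots\<close>

lemma wave_A_params_roots: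
  assumes "wave_A_params c d e u1 u2 u3 u4 \<nu> \<kappa>"
  shows "u1 + u2 + u3 + u4 = 0"
    and "c = - (u1 * u2 + u1 * u3 + u1 * u4 + u2 * u3 + u2 * u4 + u3 * u4)"
    and "2 * e = u1 * u2 * u3 + u1 * u2 * u4 + u1 * u3 * u4 + u2 * u3 * u4"
    and "d = u1 * u2 * u3 * u4"
  using assms by (auto simp: wave_A_params_def mkdv_quartic_def algebra_simps)

text \<open>Positivity of \<open>\<kappa>\<close> separates the outer pairs. For the middle pair,
  \<open>\<kappa> < 1\<close> is combined with \<open>(u1 - u3) (u2 - u4) - (u1 - u2) (u3 - u4) =
  (u1 - u4) (u2 - u3)\<close>.\<close>

lemma wave_A_params_strict:
  assumes "wave_A_params c d e u1 u2 u3 u4 \<nu> \<kappa>"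
  shows "u4 < u3" "u3 < u2" "u2 < u1"
proof -
  have ord: "u4 \<le> u3" "u3 \<le> u2" "u2 \<le> u1" and pos: "0 < \<nu>" "0 < \<kappa>" "\<kappa> < 1"
    and \<nu>: "4 * \<nu>\<^sup>2 = (u1 - u3) * (u2 - u4)" and \<kappa>: "4 * \<nu>\<^sup>2 * \<kappa>\<^sup>2 = (u1 - u2) * (u3 - u4)"
    using assms by (auto simp: wave_A_params_def)
  have "(u1 - u2) * (u3 - u4) > 0"
    using pos by (simp flip: \<kappa>)
  then show "u4 < u3" "u2 < u1"
    using ord by (auto simp: zero_less_mult_iff)
  have "\<kappa>\<^sup>2 < 1"
    using pos by (simp add: power_less_one_iff)
  then have "4 * \<nu>\<^sup>2 * \<kappa>\<^sup>2 < 4 * \<nu>\<^sup>2"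
    using pos by simp
  then have "(u1 - u4) * (u2 - u3) > 0"
    unfolding \<kappa> unfolding \<nu> by (simp add: algebra_simps)
  then show "u3 < u2"
    using ord by (auto simp: zero_less_mult_iff)
qed

text \<open>
  In terms of the denominator \<open>Y\<close> of the wave \<open>u = u4 + A (A + B) / Y\<close>, which satisfies
  \<open>(Y')\<^sup>2 = T(Y)\<close> and \<open>2 Y'' = T'(Y)\<close> for a cubic \<open>T\<close>, the two wave equations become the following
  identities.
\<close>
lemma wave_A_identities:
  fixes A B C Y :: real
  assumes "Y \<noteq> 0"
  defines "N \<equiv> A * (A + B)"
  defines "T \<equiv> (Y - A) * (A + B - Y) * (N - C * Y)"
  defines "T' \<equiv> (A + B - Y) * (N - C * Y) - (Y - A) * (N - C * Y) - C * (Y - A) * (A + B - Y)"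
  defines "X1 \<equiv> N / Y - (A + B)" and "X2 \<equiv> N / Y - A" and "X3 \<equiv> N / Y - C" and "X4 \<equiv> N / Y"
  shows "N\<^sup>2 * T / Y ^ 4 = - (X1 * X2 * X3 * X4)"
    and "4 * N * T / Y ^ 3 - N * T' / Y\<^sup>2 =
      - (X1 * X2 * X3 + X1 * X2 * X4 + X1 * X3 * X4 + X2 * X3 * X4)"
proof -
  have X: "X1 = (A + B) * (A - Y) / Y" "X2 = A * (A + B - Y) / Y" "X3 = (N - C * Y) / Y" "X4 = N / Y"
    using assms(1) by (simp_all add: X1_def X2_def X3_def X4_def N_def field_simps)
  have "N\<^sup>2 * T / Y ^ 4 =
      - ((A + B) * (A - Y) * (A * (A + B - Y)) * (N - C * Y) * N) / Y ^ 4"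
    unfolding T_def N_def by algebra
  also have "\<dots> = - (X1 * X2 * X3 * X4)"
    unfolding X by (simp add: power4_eq_xxxx mult.assoc)
  finally show "N\<^sup>2 * T / Y ^ 4 = - (X1 * X2 * X3 * X4)" .
  have poly: "N * (4 * T - T' * Y) = - ((A + B) * (A - Y) * (A * (A + B - Y)) * (N - C * Y)
      + (A + B) * (A - Y) * (A * (A + B - Y)) * N + (A + B) * (A - Y) * (N - C * Y) * N
      + A * (A + B - Y) * (N - C * Y) * N)"
    unfolding T_def T'_def N_def by algebra
  have "4 * N * T / Y ^ 3 - N * T' / Y\<^sup>2 = N * (4 * T - T' * Y) / Y ^ 3"
    using assms(1) by (simp add: field_simps power2_eq_square power3_eq_cube)
  also have "\<dots> = - (X1 * X2 * X3 + X1 * X2 * X4 + X1 * X3 * X4 + X2 * X3 * X4)"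
  proof -
    have "- (p * q * r + p * q * s + p * r * s + q * r * s) / Y ^ 3 =
        - (p / Y * (q / Y) * (r / Y) + p / Y * (q / Y) * (s / Y) + p / Y * (r / Y) * (s / Y)
          + q / Y * (r / Y) * (s / Y))" for p q r s
      by (simp add: diff_divide_distrib power3_eq_cube)
    then show ?thesis
      unfolding poly X .
  qed
  finally show "4 * N * T / Y ^ 3 - N * T' / Y\<^sup>2 =
      - (X1 * X2 * X3 + X1 * X2 * X4 + X1 * X3 * X4 + X2 * X3 * X4)" .
qed

text \<open>These are \<open>- P(u)\<close> and its derivative in factored form, to be matched with
  \<open>v\<^sup>2\<close> and \<open>2 v'\<close>.\<close>

lemma quartic_roots_identities:
  fixes u :: real
  assumes "u1 + u2 + u3 + u4 = 0"
    and "c = - (u1 * u2 + u1 * u3 + u1 * u4 + u2 * u3 + u2 * u4 + u3 * u4)"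
    and "2 * e = u1 * u2 * u3 + u1 * u2 * u4 + u1 * u3 * u4 + u2 * u3 * u4"
    and "d = u1 * u2 * u3 * u4"
  shows "2 * e * u - u ^ 4 + c * u\<^sup>2 - d = - ((u - u1) * (u - u2) * (u - u3) * (u - u4))"
    and "2 * (e + c * u - 2 * u ^ 3) = - ((u - u1) * (u - u2) * (u - u3) + (u - u1) * (u - u2) * (u - u4)
      + (u - u1) * (u - u3) * (u - u4) + (u - u2) * (u - u3) * (u - u4))"
proof -
  have u4: "u4 = - u1 - u2 - u3"
    using assms(1) by simp
  show "2 * e * u - u ^ 4 + c * u\<^sup>2 - d = - ((u - u1) * (u - u2) * (u - u3) * (u - u4))"
    unfolding assms(2-4) u4 by algebra
  have "2 * (e + c * u - 2 * u ^ 3) = 2 * e + 2 * c * u - 4 * u ^ 3"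
    by simp
  then show "2 * (e + c * u - 2 * u ^ 3) = - ((u - u1) * (u - u2) * (u - u3) + (u - u1) * (u - u2) * (u - u4)
      + (u - u1) * (u - u3) * (u - u4) + (u - u2) * (u - u3) * (u - u4))"
    unfolding assms(2-4) u4 by algebra
qed

lemma wave_A_wave:
  assumes params: "wave_A_params c d e u1 u2 u3 u4 \<nu> \<kappa>"
  obtains v where "mkdv_wave (wave_A u1 u2 u4 \<nu> \<kappa>) v c d e (ellipticF \<kappa> pi / \<nu>)"
proof -
  have pos: "0 < \<nu>" "0 < \<kappa>" "\<kappa> < 1"
    and \<nu>: "4 * \<nu>\<^sup>2 = (u1 - u3) * (u2 - u4)" and \<kappa>: "4 * \<nu>\<^sup>2 * \<kappa>\<^sup>2 = (u1 - u2) * (u3 - u4)"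
    using params by (auto simp: wave_A_params_def)
  interpret jacobi_modulus \<kappa>
    using pos by unfold_locales (simp add: abs_square_less_1)
  note strict = wave_A_params_strict[OF params]
  define A where "A = u2 - u4"
  define B where "B = u1 - u2"
  define C where "C = u3 - u4"
  define s where "s x = jacobi_sn \<kappa> (\<nu> * x)" for x
  define cn where "cn x = jacobi_cn \<kappa> (\<nu> * x)" for x
  define dl where "dl x = dn (\<nu> * x)" for x
  define Y where "Y x = A + B * (s x)\<^sup>2" for x
  define Y1 where "Y1 x = 2 * B * \<nu> * (s x * cn x * dl x)" for x
  define Y2 where "Y2 x = 2 * B * \<nu>\<^sup>2 *
    ((cn x)\<^sup>2 * (dl x)\<^sup>2 - (s x)\<^sup>2 * (dl x)\<^sup>2 - \<kappa>\<^sup>2 * (s x)\<^sup>2 * (cn x)\<^sup>2)" for x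
  define N where "N = A * (A + B)"
  \<comment> \<open>The three factors are B sn^2, B cn^2 and 4 \<nu>^2 dn^2, whose product is the
    square of \<open>Y1\<close>.\<close>
  define T where "T x = (Y x - A) * (A + B - Y x) * (N - C * Y x)" for x
  define T' where "T' x = (A + B - Y x) * (N - C * Y x) - (Y x - A) * (N - C * Y x)
    - C * (Y x - A) * (A + B - Y x)" for x
  have [derivative_intros]:
    "(s has_real_derivative \<nu> * (cn x * dl x)) (at x)"
    "(cn has_real_derivative - \<nu> * (s x * dl x)) (at x)"
    "(dl has_real_derivative - \<nu> * \<kappa>\<^sup>2 * (s x * cn x)) (at x)" for x
    unfolding s_def[abs_def] cn_def[abs_def] dl_def[abs_def]
    by (rule DERIV_sn_scaled DERIV_cn_scaled DERIV_dn_scaled)+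
  have AB: "0 < A" "0 < B"
    using strict by (simp_all add: A_def B_def)
  have Y_pos: "0 < Y x" for x
    using AB by (simp add: Y_def add_pos_nonneg)
  have cn2: "(cn x)\<^sup>2 = 1 - (s x)\<^sup>2" for x
    using sn_cn_squared[of "\<nu> * x"] by (simp add: s_def cn_def)
  have dl2: "(dl x)\<^sup>2 = 1 - \<kappa>\<^sup>2 * (s x)\<^sup>2" for x
    using dn_squared[of "\<nu> * x"] by (simp add: s_def dl_def)
  have \<nu>_dl: "4 * \<nu>\<^sup>2 * (dl x)\<^sup>2 = N - C * Y x" for x
  proof -
    have "4 * \<nu>\<^sup>2 * (dl x)\<^sup>2 = 4 * \<nu>\<^sup>2 - 4 * \<nu>\<^sup>2 * \<kappa>\<^sup>2 * (s x)\<^sup>2"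
      unfolding dl2 by (simp add: algebra_simps)
    then show ?thesis
      unfolding \<kappa> unfolding \<nu> N_def Y_def A_def B_def C_def by algebra
  qed
  have Bs: "B * (s x)\<^sup>2 = Y x - A" "B * (cn x)\<^sup>2 = A + B - Y x" for x
    by (simp_all add: Y_def cn2 algebra_simps)
  have Y1_sq: "(Y1 x)\<^sup>2 = T x" for x
  proof -
    have "(Y1 x)\<^sup>2 = (B * (s x)\<^sup>2) * (B * (cn x)\<^sup>2) * (4 * \<nu>\<^sup>2 * (dl x)\<^sup>2)"
      unfolding Y1_def by (simp add: power_mult_distrib power2_eq_square)
    then show ?thesis
      unfolding T_def Bs \<nu>_dl .
  qed
  have Y2_eq: "2 * Y2 x = T' x" for x
  proof -
    have "2 * Y2 x = B * (cn x)\<^sup>2 * (4 * \<nu>\<^sup>2 * (dl x)\<^sup>2) - B * (s x)\<^sup>2 * (4 * \<nu>\<^sup>2 * (dl x)\<^sup>2)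
        - (4 * \<nu>\<^sup>2 * \<kappa>\<^sup>2) * (s x)\<^sup>2 * (B * (cn x)\<^sup>2)"
      unfolding Y2_def by (simp add: algebra_simps)
    also have "(4 * \<nu>\<^sup>2 * \<kappa>\<^sup>2) * (s x)\<^sup>2 = C * (B * (s x)\<^sup>2)"
      unfolding \<kappa> by (simp add: B_def C_def)
    finally show ?thesis
      unfolding T'_def Bs \<nu>_dl .
  qed
  have u_eq: "wave_A u1 u2 u4 \<nu> \<kappa> = (\<lambda>x. u4 + N / Y x)"
    by (rule ext) (simp add: wave_A_def N_def Y_def A_def B_def s_def ac_simps)
  have diffs: "u4 + N / Y x - u1 = N / Y x - (A + B)" "u4 + N / Y x - u2 = N / Y x - A"
    "u4 + N / Y x - u3 = N / Y x - C" "u4 + N / Y x - u4 = N / Y x" for x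
    by (simp_all add: A_def B_def C_def)
  have Y_deriv: "(Y has_real_derivative Y1 x) (at x)" for x
    unfolding Y_def[abs_def] by (auto intro!: derivative_eq_intros simp: Y1_def)
  have Y1_deriv: "(Y1 has_real_derivative Y2 x) (at x)" for x
    unfolding Y1_def[abs_def]
    by (auto intro!: derivative_eq_intros simp: Y2_def algebra_simps power2_eq_square)
  note ids = wave_A_identities[of "Y _" A B C, folded N_def, folded T_def T'_def, OF less_imp_neq[OF Y_pos, symmetric]]
  show thesis
  proof (rule that, unfold_locales)
    fix x
    show "(wave_A u1 u2 u4 \<nu> \<kappa> has_real_derivative - N * Y1 x / (Y x)\<^sup>2) (at x)"
      unfolding u_eq using Y_pos[of x]
      by (auto intro!: derivative_eq_intros Y_deriv simp: power2_eq_square)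
    have "((\<lambda>x. - N * Y1 x / (Y x)\<^sup>2) has_real_derivative 2 * N * (Y1 x)\<^sup>2 / (Y x) ^ 3 - N * Y2 x / (Y x)\<^sup>2) (at x)"
      using Y_pos[of x]
      by (auto intro!: derivative_eq_intros Y_deriv Y1_deriv simp: field_simps eval_nat_numeral)
    also have "2 * N * (Y1 x)\<^sup>2 / (Y x) ^ 3 - N * Y2 x / (Y x)\<^sup>2
        = (4 * N * T x / (Y x) ^ 3 - N * T' x / (Y x)\<^sup>2) / 2"
      unfolding Y1_sq Y2_eq[symmetric] by (simp add: field_simps)
    also have "\<dots> = 2 * (e + c * wave_A u1 u2 u4 \<nu> \<kappa> x - 2 * (wave_A u1 u2 u4 \<nu> \<kappa> x) ^ 3) / 2"
      unfolding ids u_eq quartic_roots_identities(2)[OF wave_A_params_roots[OF params]] diffs ..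
    also have "\<dots> = e + c * wave_A u1 u2 u4 \<nu> \<kappa> x - 2 * (wave_A u1 u2 u4 \<nu> \<kappa> x) ^ 3"
      by simp
    finally show "((\<lambda>x. - N * Y1 x / (Y x)\<^sup>2) has_real_derivative
        e + c * wave_A u1 u2 u4 \<nu> \<kappa> x - 2 * (wave_A u1 u2 u4 \<nu> \<kappa> x) ^ 3) (at x)" .
    have "(- N * Y1 x / (Y x)\<^sup>2)\<^sup>2 = N\<^sup>2 * T x / (Y x) ^ 4"
      by (simp add: power_divide power_mult_distrib Y1_sq)
    also have "\<dots> = 2 * e * wave_A u1 u2 u4 \<nu> \<kappa> x - (wave_A u1 u2 u4 \<nu> \<kappa> x) ^ 4
        + c * (wave_A u1 u2 u4 \<nu> \<kappa> x)\<^sup>2 - d"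
      unfolding ids u_eq quartic_roots_identities(1)[OF wave_A_params_roots[OF params]] diffs ..
    finally show "(- N * Y1 x / (Y x)\<^sup>2)\<^sup>2 = 2 * e * wave_A u1 u2 u4 \<nu> \<kappa> x - (wave_A u1 u2 u4 \<nu> \<kappa> x) ^ 4
        + c * (wave_A u1 u2 u4 \<nu> \<kappa> x)\<^sup>2 - d" .
    show "0 < ellipticF \<kappa> pi / \<nu>"
      using ellipticF_pi_pos pos by simp
    show "wave_A u1 u2 u4 \<nu> \<kappa> (x + ellipticF \<kappa> pi / \<nu>) = wave_A u1 u2 u4 \<nu> \<kappa> x"
      using pos by (simp add: wave_A_def distrib_left sn_add_half_period)
  qed
qed

text \<open>The value \<open>u1\<close> taken at 0 is reached again only when the denominator
  returns to \<open>u2 - u4\<close>, that is, at a zero of sn.\<close>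

lemma wave_A_fundamental_period:
  assumes params: "wave_A_params c d e u1 u2 u3 u4 \<nu> \<kappa>"
  shows "fundamental_period (wave_A u1 u2 u4 \<nu> \<kappa>) (ellipticF \<kappa> pi / \<nu>)"
proof -
  have pos: "0 < \<nu>" "0 < \<kappa>" "\<kappa> < 1"
    using params by (auto simp: wave_A_params_def)
  interpret jacobi_modulus \<kappa>
    using pos by unfold_locales (simp add: abs_square_less_1)
  note strict = wave_A_params_strict[OF params]
  obtain v where "mkdv_wave (wave_A u1 u2 u4 \<nu> \<kappa>) v c d e (ellipticF \<kappa> pi / \<nu>)"
    using wave_A_wave[OF params] .
  then interpret mkdv_wave "wave_A u1 u2 u4 \<nu> \<kappa>" v c d e "ellipticF \<kappa> pi / \<nu>" .
  have "ellipticF \<kappa> pi / \<nu> \<le> T" if "0 < T" and T: "periodic_fun_simple (wave_A u1 u2 u4 \<nu> \<kappa>) T" for T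
  proof -
    have "wave_A u1 u2 u4 \<nu> \<kappa> T = wave_A u1 u2 u4 \<nu> \<kappa> 0"
      using T by (metis add_0 periodic_fun_simple_def)
    also have "\<dots> = u1"
      using strict by (simp add: wave_A_def jacobi_sn_def)
    finally have "(u1 - u4) * (u2 - u4) / (u2 - u4 + (u1 - u2) * (jacobi_sn \<kappa> (\<nu> * T))\<^sup>2) = u1 - u4"
      by (simp add: wave_A_def)
    moreover have "0 < u2 - u4 + (u1 - u2) * (jacobi_sn \<kappa> (\<nu> * T))\<^sup>2"
      using strict by (intro add_pos_nonneg) auto
    ultimately have "jacobi_sn \<kappa> (\<nu> * T) = 0"
      using strict by (simp add: nonzero_divide_eq_eq)
    then show ?thesis
      using sn_eq_0_imp_ge[of "\<nu> * T"] pos \<open>0 < T\<close> by (simp add: field_simps)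
  qed
  then show ?thesis
    using period_pos periodic by (simp add: fundamental_period_def periodic_fun_simple_def)
qed

lemma wave_A_eigenvalues:
  assumes params: "wave_A_params c d e u1 u2 u3 u4 \<nu> \<kappa>"
  defines "u \<equiv> wave_A u1 u2 u4 \<nu> \<kappa>" and "L \<equiv> ellipticF \<kappa> pi / \<nu>"
  shows "periodic_eigenvalue u L (of_real ((u1 + u2) / 2))"
    and "periodic_eigenvalue u (2 * L) (of_real ((u1 + u2) / 2))"
    and "periodic_eigenvalue u (2 * L) (of_real ((u1 + u3) / 2))"
    and "periodic_eigenvalue u (2 * L) (of_real ((u2 + u3) / 2))"
proof -
  note strict = wave_A_params_strict[OF params]
  note roots = wave_A_params_roots[OF params]
  have u4: "u4 = - u1 - u2 - u3"
    using roots(1) by simp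
  obtain v where "mkdv_wave u v c d e L"
    using wave_A_wave[OF params] unfolding u_def L_def .
  then interpret mkdv_wave u v c d e L .
  have cases: "u x = u1 \<or> u x = u2 \<or> u x = u3 \<or> u x = u4" if "v x = 0" for x
    using energy[of x] that unfolding quartic_roots_identities(1)[OF roots] by auto
  \<comment> \<open>The constants come from matching \<open>(u - r1) (u - r2)\<close> with
    \<open>u\<^sup>2 - 2 k - S\<close> and \<open>(u - r3) (u - r4)\<close> with
    \<open>u\<^sup>2 - 2 k + S\<close>, where \<open>S = 2 l u + m\<close>.\<close>
  have factorization: "mkdv_real_factorization u v c d e L ((r1 + r2) / 2) (- (r1 * r2 + r3 * r4) / 4)
      ((r3 * r4 - r1 * r2) / 2)"
    if "r4 = - r1 - r2 - r3" "c = - (r1 * r2 + r1 * r3 + r1 * r4 + r2 * r3 + r2 * r4 + r3 * r4)"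
      "2 * e = r1 * r2 * r3 + r1 * r2 * r4 + r1 * r3 * r4 + r2 * r3 * r4"
      "d = r1 * r2 * r3 * r4" for r1 r2 r3 r4
  proof unfold_locales
    show "c = 4 * ((r1 + r2) / 2)\<^sup>2 + 4 * (- (r1 * r2 + r3 * r4) / 4)"
      unfolding that(2) that(1) by (simp add: field_simps power2_eq_square)
    have "2 * e = 2 * (2 * ((r1 + r2) / 2) * ((r3 * r4 - r1 * r2) / 2))"
      unfolding that(3) that(1) by (simp add: field_simps)
    then show "e = 2 * ((r1 + r2) / 2) * ((r3 * r4 - r1 * r2) / 2)"
      by linarith
    show "d = 4 * (- (r1 * r2 + r3 * r4) / 4)\<^sup>2 - ((r3 * r4 - r1 * r2) / 2)\<^sup>2"
      unfolding that(4) by (simp add: field_simps power2_eq_square)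
  qed
  \<comment> \<open>The two quadratic factors add up to \<open>2 u\<^sup>2 - 4 k\<close>. At a root
    one of them vanishes, so \<open>u\<^sup>2 / 2 - k\<close> is a quarter of the other.\<close>
  have residual: "(u x)\<^sup>2 / 2 - (- (r1 * r2 + r3 * r4) / 4) \<in>
      {(r1 - r3) * (r1 - r4) / 4, (r2 - r3) * (r2 - r4) / 4, (r3 - r1) * (r3 - r2) / 4,
       (r4 - r1) * (r4 - r2) / 4}"
    if "u x = r1 \<or> u x = r2 \<or> u x = r3 \<or> u x = r4" and r4: "r4 = - r1 - r2 - r3"
    for x r1 r2 r3 r4
  proof -
    have "r1\<^sup>2 / 2 - (- (r1 * r2 + r3 * r4) / 4) = (r1 - r3) * (r1 - r4) / 4"
      "r2\<^sup>2 / 2 - (- (r1 * r2 + r3 * r4) / 4) = (r2 - r3) * (r2 - r4) / 4"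
      "r3\<^sup>2 / 2 - (- (r1 * r2 + r3 * r4) / 4) = (r3 - r1) * (r3 - r2) / 4"
      "r4\<^sup>2 / 2 - (- (r1 * r2 + r3 * r4) / 4) = (r4 - r1) * (r4 - r2) / 4"
      unfolding r4 by (simp_all add: field_simps power2_eq_square)
    with that(1) show ?thesis
      by auto
  qed
  have F12: "mkdv_real_factorization u v c d e L ((u1 + u2) / 2) (- (u1 * u2 + u3 * u4) / 4)
    ((u3 * u4 - u1 * u2) / 2)"
    by (rule factorization[OF u4 roots(2-4)])
  \<comment> \<open>Both roots of one pair lie above both roots of the other, so every residual is
    positive.\<close>
  have "- (u1 * u2 + u3 * u4) / 4 < (u x)\<^sup>2 / 2" if "v x = 0" for x
  proof -
    have "\<forall>z\<in>{(u1 - u3) * (u1 - u4) / 4, (u2 - u3) * (u2 - u4) / 4,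
        (u3 - u1) * (u3 - u2) / 4, (u4 - u1) * (u4 - u2) / 4}. 0 < z"
      using strict by (simp add: zero_less_mult_iff)
    from bspec[OF this residual[OF cases[OF that] u4]]
    show ?thesis
      by simp
  qed
  then show "periodic_eigenvalue u L (of_real ((u1 + u2) / 2))"
    and "periodic_eigenvalue u (2 * L) (of_real ((u1 + u2) / 2))"
    using mkdv_real_factorization.periodic_eigenvalue_single_period[OF F12]
      mkdv_real_factorization.periodic_eigenvalue_double_period[OF F12] by force+
  have F13: "mkdv_real_factorization u v c d e L ((u1 + u3) / 2) (- (u1 * u3 + u2 * u4) / 4)
    ((u2 * u4 - u1 * u3) / 2)"
    by (rule factorization; (unfold roots(2-4))?) (simp_all add: u4 algebra_simps)
  \<comment> \<open>Now the residuals at \<open>u1\<close> and \<open>u2\<close> have opposite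
    signs, so only nonvanishing is available.\<close>
  have "(u x)\<^sup>2 / 2 \<noteq> - (u1 * u3 + u2 * u4) / 4" if "v x = 0" for x
  proof -
    have "\<forall>z\<in>{(u1 - u2) * (u1 - u4) / 4, (u3 - u2) * (u3 - u4) / 4,
        (u2 - u1) * (u2 - u3) / 4, (u4 - u1) * (u4 - u3) / 4}. z \<noteq> 0"
      using strict by simp
    moreover have "u x = u1 \<or> u x = u3 \<or> u x = u2 \<or> u x = u4" "u4 = - u1 - u3 - u2"
      using cases[OF that] u4 by auto
    note residual[OF this]
    ultimately have "(u x)\<^sup>2 / 2 - (- (u1 * u3 + u2 * u4) / 4) \<noteq> 0"
      by blast
    then show ?thesis
      unfolding right_minus_eq .
  qed
  then show "periodic_eigenvalue u (2 * L) (of_real ((u1 + u3) / 2))"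
    by (rule mkdv_real_factorization.periodic_eigenvalue_double_period[OF F13])
  have F23: "mkdv_real_factorization u v c d e L ((u2 + u3) / 2) (- (u2 * u3 + u1 * u4) / 4)
    ((u1 * u4 - u2 * u3) / 2)"
    by (rule factorization; (unfold roots(2-4))?) (simp_all add: u4 algebra_simps)
  have "(u x)\<^sup>2 / 2 \<noteq> - (u2 * u3 + u1 * u4) / 4" if "v x = 0" for x
  proof -
    have "\<forall>z\<in>{(u2 - u1) * (u2 - u4) / 4, (u3 - u1) * (u3 - u4) / 4,
        (u1 - u2) * (u1 - u3) / 4, (u4 - u2) * (u4 - u3) / 4}. z \<noteq> 0"
      using strict by simp
    moreover have "u x = u2 \<or> u x = u3 \<or> u x = u1 \<or> u x = u4" "u4 = - u2 - u3 - u1"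
      using cases[OF that] u4 by auto
    note residual[OF this]
    ultimately have "(u x)\<^sup>2 / 2 - (- (u2 * u3 + u1 * u4) / 4) \<noteq> 0"
      by blast
    then show ?thesis
      unfolding right_minus_eq .
  qed
  then show "periodic_eigenvalue u (2 * L) (of_real ((u2 + u3) / 2))"
    by (rule mkdv_real_factorization.periodic_eigenvalue_double_period[OF F23])
qed

section \<open>The wave with two real roots\<close>

lemma wave_B_params_roots:
  assumes "wave_B_params c d e a b \<alpha> \<beta> \<delta> \<nu> \<kappa>"
  shows "a + b + 2 * \<alpha> = 0"
    and "c = - (a * b + 2 * \<alpha> * (a + b) + \<alpha>\<^sup>2 + \<beta>\<^sup>2)"
    and "2 * e = 2 * a * b * \<alpha> + (a + b) * (\<alpha>\<^sup>2 + \<beta>\<^sup>2)"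
    and "d = a * b * (\<alpha>\<^sup>2 + \<beta>\<^sup>2)"
  using assms
  by (auto simp: wave_B_params_def mkdv_quartic_def map_poly_pCons complex_eq_iff algebra_simps
      power2_eq_square)

text \<open>If \<open>a = b\<close>, the fraction in the formula for \<open>\<kappa>\<close> equals
  1, which forces \<open>\<kappa> = 0\<close>.\<close>

lemma wave_B_params_strict:
  assumes "wave_B_params c d e a b \<alpha> \<beta> \<delta> \<nu> \<kappa>"
  shows "b < a" "\<beta> \<noteq> 0"
proof -
  show \<beta>: "\<beta> \<noteq> 0"
    using assms by (simp add: wave_B_params_def)
  have "a \<noteq> b"
  proof
    assume "a = b"
    have "0 < (b - \<alpha>)\<^sup>2 + \<beta>\<^sup>2"
      using \<beta> by (simp add: add_nonneg_pos)
    then have "2 * \<kappa>\<^sup>2 = 0"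
      using assms \<open>a = b\<close> by (simp add: wave_B_params_def power2_eq_square)
    then show False
      using assms by (simp add: wave_B_params_def)
  qed
  then show "b < a"
    using assms by (simp add: wave_B_params_def)
qed

text \<open>The radicand is a perfect square, \<open>(\<delta> M)\<^sup>2\<close> with
  \<open>M = A\<^sup>2 + \<beta>\<^sup>2\<close>, so the parameter relations become
  polynomial.\<close>

lemma wave_B_params_modulus:
  fixes a b \<alpha> \<beta> \<delta> \<nu> \<kappa> :: real
  assumes "wave_B_params c d e a b \<alpha> \<beta> \<delta> \<nu> \<kappa>"
  defines "A \<equiv> a - \<alpha>" and "B \<equiv> b - \<alpha>"
  shows "\<delta>\<^sup>2 * (A\<^sup>2 + \<beta>\<^sup>2) = B\<^sup>2 + \<beta>\<^sup>2"
    and "\<nu>\<^sup>2 = \<delta> * (A\<^sup>2 + \<beta>\<^sup>2)"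
    and "A * B + \<beta>\<^sup>2 = \<delta> * (A\<^sup>2 + \<beta>\<^sup>2) * (1 - 2 * \<kappa>\<^sup>2)"
proof -
  define M where "M = A\<^sup>2 + \<beta>\<^sup>2"
  have "0 < M"
    using wave_B_params_strict[OF assms(1)] by (simp add: M_def add_nonneg_pos)
  have \<delta>: "0 < \<delta>" "\<delta>\<^sup>2 = (B\<^sup>2 + \<beta>\<^sup>2) / M" and \<nu>: "\<nu>\<^sup>2 = sqrt (M * (B\<^sup>2 + \<beta>\<^sup>2))"
    and \<kappa>: "2 * \<kappa>\<^sup>2 = 1 - (A * B + \<beta>\<^sup>2) / sqrt (M * (B\<^sup>2 + \<beta>\<^sup>2))"
    using assms(1) by (simp_all add: wave_B_params_def A_def B_def M_def)
  show eq: "\<delta>\<^sup>2 * (A\<^sup>2 + \<beta>\<^sup>2) = B\<^sup>2 + \<beta>\<^sup>2"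
    using \<delta>(2) \<open>0 < M\<close> by (simp flip: M_def)
  have "M * (B\<^sup>2 + \<beta>\<^sup>2) = (\<delta> * M)\<^sup>2"
    unfolding eq[symmetric] M_def by algebra
  then have sqrt: "sqrt (M * (B\<^sup>2 + \<beta>\<^sup>2)) = \<delta> * M"
    using \<delta>(1) \<open>0 < M\<close> by simp
  show "\<nu>\<^sup>2 = \<delta> * (A\<^sup>2 + \<beta>\<^sup>2)"
    using \<nu> sqrt by (simp add: M_def)
  show "A * B + \<beta>\<^sup>2 = \<delta> * (A\<^sup>2 + \<beta>\<^sup>2) * (1 - 2 * \<kappa>\<^sup>2)"
    using \<kappa> \<delta>(1) \<open>0 < M\<close> unfolding sqrt M_def[symmetric] by (simp add: field_simps)
qed

text \<open>
  The wave is \<open>u = a + (b - a) (1 - y) / Z\<close> with \<open>y\<close> the elliptic cosine; \<open>W / Z\<close> is \<open>u - \<alpha>\<close> and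
  \<open>K = 4 \<nu>\<^sup>2 \<delta> (1 - \<kappa>\<^sup>2 + \<kappa>\<^sup>2 y\<^sup>2)\<close>, so that \<open>4 \<delta> (y')\<^sup>2 = (1 - y\<^sup>2) K\<close>.
\<close>
lemma wave_B_identities:
  fixes A B \<beta> \<delta> \<kappa> y :: real
  defines "M \<equiv> A\<^sup>2 + \<beta>\<^sup>2"
  defines "Z \<equiv> 1 + \<delta> + (\<delta> - 1) * y"
  defines "W \<equiv> A * \<delta> * (1 + y) + B * (1 - y)"
  defines "K \<equiv> 4 * \<delta>\<^sup>2 * M * (1 - \<kappa>\<^sup>2 + \<kappa>\<^sup>2 * y\<^sup>2)"
  assumes \<delta>: "\<delta>\<^sup>2 * M = B\<^sup>2 + \<beta>\<^sup>2" and \<kappa>: "A * B + \<beta>\<^sup>2 = \<delta> * M * (1 - 2 * \<kappa>\<^sup>2)"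
  shows "W\<^sup>2 + \<beta>\<^sup>2 * Z\<^sup>2 = K"
    and "K * (\<delta> - 1) - Z * (4 * \<delta>\<^sup>2 * M * \<kappa>\<^sup>2 * y) = - 2 * (A - B) * \<delta> * W"
proof -
  have "W\<^sup>2 + \<beta>\<^sup>2 * Z\<^sup>2 = \<delta>\<^sup>2 * (1 + y)\<^sup>2 * M + (1 - y)\<^sup>2 * (B\<^sup>2 + \<beta>\<^sup>2)
      + 2 * \<delta> * (1 - y\<^sup>2) * (A * B + \<beta>\<^sup>2)"
    unfolding W_def Z_def M_def by algebra
  also have "\<dots> = K"
    unfolding \<kappa> \<delta>[symmetric] K_def by algebra
  finally show "W\<^sup>2 + \<beta>\<^sup>2 * Z\<^sup>2 = K" .
  \<comment> \<open>Up to a constant factor and a power of \<open>Z\<close>, the second identity is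
    the derivative in \<open>y\<close> of
    \<open>K / Z\<^sup>2 = (W / Z)\<^sup>2 + \<beta>\<^sup>2\<close>. The terms in
    \<open>y\<^sup>2\<close> cancel, and the two remaining coefficients are compared
    separately.\<close>
  define p where "p = 4 * \<delta>\<^sup>2 * M * \<kappa>\<^sup>2"
  define q where "q = \<delta>\<^sup>2 * M"
  have p: "p = 2 * q - 2 * \<delta> * (A * B + \<beta>\<^sup>2)"
    unfolding p_def q_def \<kappa> by algebra
  have "K = 4 * q - p + p * y\<^sup>2"
    unfolding K_def p_def q_def by algebra
  then have "K * (\<delta> - 1) - Z * (p * y) = (4 * q - p) * (\<delta> - 1) - (1 + \<delta>) * p * y"
    unfolding Z_def by algebra
  also have "(4 * q - p) * (\<delta> - 1) = - 2 * (A - B) * \<delta> * (A * \<delta> + B)"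
  proof -
    have "(4 * q - p) * (\<delta> - 1) = (2 * q + 2 * \<delta> * (A * B + \<beta>\<^sup>2)) * (\<delta> - 1)"
      unfolding p by algebra
    also have "\<dots> = (q + (B\<^sup>2 + \<beta>\<^sup>2) + 2 * \<delta> * (A * B + \<beta>\<^sup>2)) * (\<delta> - 1)"
      unfolding \<delta>[symmetric] q_def by algebra
    also have "\<dots> = ((A * \<delta> + B)\<^sup>2 + \<beta>\<^sup>2 * (1 + \<delta>)\<^sup>2) * (\<delta> - 1)"
      unfolding q_def M_def by algebra
    also have "\<dots> = - 2 * (A - B) * \<delta> * (A * \<delta> + B)
        + (1 + \<delta>) * (A\<^sup>2 * \<delta>\<^sup>2 - B\<^sup>2 + \<beta>\<^sup>2 * (\<delta>\<^sup>2 - 1))"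
      by algebra
    also have "A\<^sup>2 * \<delta>\<^sup>2 - B\<^sup>2 + \<beta>\<^sup>2 * (\<delta>\<^sup>2 - 1) = 0"
      using \<delta> unfolding M_def by algebra
    finally show ?thesis
      by simp
  qed
  also have "(1 + \<delta>) * p = 2 * (A - B) * \<delta> * (A * \<delta> - B)"
  proof -
    have "(1 + \<delta>) * p = (2 * q - 2 * \<delta> * (A * B + \<beta>\<^sup>2)) * (1 + \<delta>)"
      unfolding p by algebra
    also have "\<dots> = (q + (B\<^sup>2 + \<beta>\<^sup>2) - 2 * \<delta> * (A * B + \<beta>\<^sup>2)) * (1 + \<delta>)"
      unfolding \<delta>[symmetric] q_def by algebra
    also have "\<dots> = ((A * \<delta> - B)\<^sup>2 + \<beta>\<^sup>2 * (\<delta> - 1)\<^sup>2) * (1 + \<delta>)"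
      unfolding q_def M_def by algebra
    also have "\<dots> = 2 * (A - B) * \<delta> * (A * \<delta> - B)
        + (\<delta> - 1) * (A\<^sup>2 * \<delta>\<^sup>2 - B\<^sup>2 + \<beta>\<^sup>2 * (\<delta>\<^sup>2 - 1))"
      by algebra
    also have "A\<^sup>2 * \<delta>\<^sup>2 - B\<^sup>2 + \<beta>\<^sup>2 * (\<delta>\<^sup>2 - 1) = 0"
      using \<delta> unfolding M_def by algebra
    finally show ?thesis
      by simp
  qed
  finally show "K * (\<delta> - 1) - Z * (4 * \<delta>\<^sup>2 * M * \<kappa>\<^sup>2 * y) = - 2 * (A - B) * \<delta> * W"
    unfolding p_def W_def by algebra
qed

lemma quartic_complex_roots_identities:
  fixes u :: real
  assumes "a + b + 2 * \<alpha> = 0"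
    and "c = - (a * b + 2 * \<alpha> * (a + b) + \<alpha>\<^sup>2 + \<beta>\<^sup>2)"
    and "2 * e = 2 * a * b * \<alpha> + (a + b) * (\<alpha>\<^sup>2 + \<beta>\<^sup>2)"
    and "d = a * b * (\<alpha>\<^sup>2 + \<beta>\<^sup>2)"
  shows "2 * e * u - u ^ 4 + c * u\<^sup>2 - d = - ((u - a) * (u - b) * ((u - \<alpha>)\<^sup>2 + \<beta>\<^sup>2))"
    and "2 * (e + c * u - 2 * u ^ 3) = - ((u - a + (u - b)) * ((u - \<alpha>)\<^sup>2 + \<beta>\<^sup>2)
      + 2 * (u - a) * (u - b) * (u - \<alpha>))"
proof -
  have a: "a = - b - 2 * \<alpha>"
    using assms(1) by simp
  show "2 * e * u - u ^ 4 + c * u\<^sup>2 - d = - ((u - a) * (u - b) * ((u - \<alpha>)\<^sup>2 + \<beta>\<^sup>2))"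
    unfolding assms(2-4) a by algebra
  have "2 * (e + c * u - 2 * u ^ 3) = 2 * e + 2 * c * u - 4 * u ^ 3"
    by simp
  then show "2 * (e + c * u - 2 * u ^ 3) = - ((u - a + (u - b)) * ((u - \<alpha>)\<^sup>2 + \<beta>\<^sup>2)
      + 2 * (u - a) * (u - b) * (u - \<alpha>))"
    unfolding assms(2-4) a by algebra
qed

lemma wave_B_wave:
  assumes params: "wave_B_params c d e a b \<alpha> \<beta> \<delta> \<nu> \<kappa>"
  obtains v where "mkdv_wave (wave_B a b \<delta> \<nu> \<kappa>) v c d e (2 * ellipticF \<kappa> pi / \<nu>)"
proof -
  have pos: "0 < \<delta>" "0 < \<nu>" "0 < \<kappa>" "\<kappa> < 1"
    using params by (auto simp: wave_B_params_def)
  interpret jacobi_modulus \<kappa>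
    using pos by unfold_locales (simp add: abs_square_less_1)
  define A where "A = a - \<alpha>"
  define B where "B = b - \<alpha>"
  define M where "M = A\<^sup>2 + \<beta>\<^sup>2"
  define g where "g = a - b"
  note modulus = wave_B_params_modulus[OF params, folded A_def B_def, folded M_def]
  define s where "s x = jacobi_sn \<kappa> (\<nu> * x)" for x
  define y where "y x = jacobi_cn \<kappa> (\<nu> * x)" for x
  define dl where "dl x = dn (\<nu> * x)" for x
  define y1 where "y1 x = - \<nu> * (s x * dl x)" for x
  define y2 where "y2 x = - \<nu>\<^sup>2 * (y x * (dl x)\<^sup>2 - \<kappa>\<^sup>2 * (s x)\<^sup>2 * y x)" for x
  define Z where "Z x = 1 + \<delta> + (\<delta> - 1) * y x" for x
  define W where "W x = A * \<delta> * (1 + y x) + B * (1 - y x)" for x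
  define K where "K x = 4 * \<delta>\<^sup>2 * M * (1 - \<kappa>\<^sup>2 + \<kappa>\<^sup>2 * (y x)\<^sup>2)" for x
  define J where "J x = 4 * \<delta>\<^sup>2 * M * \<kappa>\<^sup>2 * y x" for x
  have [derivative_intros]:
    "(s has_real_derivative \<nu> * (y x * dl x)) (at x)"
    "(y has_real_derivative y1 x) (at x)"
    "(dl has_real_derivative - \<nu> * \<kappa>\<^sup>2 * (s x * y x)) (at x)" for x
    unfolding s_def[abs_def] y_def[abs_def] dl_def[abs_def] y1_def
    by (rule DERIV_sn_scaled DERIV_cn_scaled DERIV_dn_scaled)+
  have y1_deriv: "(y1 has_real_derivative y2 x) (at x)" for x
    unfolding y1_def[abs_def]
    by (auto intro!: derivative_eq_intros simp: y2_def algebra_simps power2_eq_square)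
  have s2: "(s x)\<^sup>2 = 1 - (y x)\<^sup>2" for x
    using sn_cn_squared[of "\<nu> * x"] by (simp add: s_def y_def)
  have dl2: "(dl x)\<^sup>2 = 1 - \<kappa>\<^sup>2 + \<kappa>\<^sup>2 * (y x)\<^sup>2" for x
    using dn_squared[of "\<nu> * x"] unfolding s_def[symmetric] dl_def[symmetric] s2
    by (simp add: algebra_simps)
  have Z_pos: "0 < Z x" for x
  proof -
    have "- 1 \<le> y x" "y x \<le> 1"
      by (simp_all add: y_def jacobi_cn_def)
    moreover have "Z x = (1 - y x) + \<delta> * (1 + y x)"
      by (simp add: Z_def algebra_simps)
    ultimately show ?thesis
      using pos(1) by (cases "y x = 1") (simp_all add: add_pos_nonneg)
  qed
  have ids: "(W x)\<^sup>2 + \<beta>\<^sup>2 * (Z x)\<^sup>2 = K x" "K x * (\<delta> - 1) - Z x * J x = - 2 * g * \<delta> * W x" for x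
    using wave_B_identities[OF modulus(1)[unfolded M_def] modulus(3)[unfolded M_def], of "y x"]
    unfolding W_def Z_def K_def J_def M_def g_def by (simp_all add: A_def B_def)
  have y1_sq: "4 * \<delta> * (y1 x)\<^sup>2 = (1 - (y x)\<^sup>2) * K x" for x
  proof -
    have "4 * \<delta> * (y1 x)\<^sup>2 = 4 * \<delta> * (\<nu>\<^sup>2 * ((s x)\<^sup>2 * (dl x)\<^sup>2))"
      by (simp add: y1_def power_mult_distrib)
    then show ?thesis
      unfolding s2 dl2 modulus(2) K_def by algebra
  qed
  have y2_eq: "4 * \<delta> * y2 x = - y x * K x + (1 - (y x)\<^sup>2) * J x" for x
    unfolding y2_def s2 dl2 modulus(2) K_def J_def by algebra
  let ?u = "wave_B a b \<delta> \<nu> \<kappa>"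
  have u_eq: "?u = (\<lambda>x. a - g * (1 - y x) / Z x)"
    by (rule ext) (simp add: wave_B_def Z_def g_def y_def left_diff_distrib diff_divide_distrib)
  have ua: "?u x - a = - g * (1 - y x) / Z x" and ub: "?u x - b = g * \<delta> * (1 + y x) / Z x"
    and u\<alpha>: "?u x - \<alpha> = W x / Z x" for x
    using Z_pos[of x] by (simp_all add: u_eq W_def field_simps) (simp_all add: Z_def g_def A_def B_def algebra_simps)
  have X3: "(?u x - \<alpha>)\<^sup>2 + \<beta>\<^sup>2 = K x / (Z x)\<^sup>2" for x
    using Z_pos[of x] ids(1)[of x] by (simp add: u\<alpha> field_simps)
  have Z_deriv: "(Z has_real_derivative (\<delta> - 1) * y1 x) (at x)" for x
    unfolding Z_def[abs_def] by (auto intro!: derivative_eq_intros)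
  show thesis
  proof (rule that, unfold_locales)
    fix x
    note Z_nz = less_imp_neq[OF Z_pos[of x], symmetric]
    have "(?u has_real_derivative g * (y1 x * Z x + (1 - y x) * ((\<delta> - 1) * y1 x)) / (Z x)\<^sup>2) (at x)"
      unfolding u_eq using Z_nz
      by (auto intro!: derivative_eq_intros Z_deriv simp: field_simps power2_eq_square)
    also have "y1 x * Z x + (1 - y x) * ((\<delta> - 1) * y1 x) = 2 * \<delta> * y1 x"
      by (simp add: Z_def algebra_simps)
    finally show "(?u has_real_derivative g * (2 * \<delta> * y1 x) / (Z x)\<^sup>2) (at x)" .
    have "((\<lambda>x. g * (2 * \<delta> * y1 x) / (Z x)\<^sup>2) has_real_derivative
        2 * \<delta> * g * (y2 x * Z x - 2 * (\<delta> - 1) * (y1 x)\<^sup>2) / (Z x) ^ 3) (at x)"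
      using Z_nz
      by (auto intro!: derivative_eq_intros Z_deriv y1_deriv simp: field_simps eval_nat_numeral)
    also have "2 * \<delta> * g * (y2 x * Z x - 2 * (\<delta> - 1) * (y1 x)\<^sup>2) / (Z x) ^ 3
        = 2 * (e + c * ?u x - 2 * (?u x) ^ 3) / 2"
    proof -
      have "4 * \<delta> * g * (y2 x * Z x - 2 * (\<delta> - 1) * (y1 x)\<^sup>2)
          = g * (4 * \<delta> * y2 x) * Z x - 2 * g * (\<delta> - 1) * (4 * \<delta> * (y1 x)\<^sup>2)"
        by (simp add: algebra_simps)
      \<comment> \<open>Grouped so that the left side of \<open>ids(2)\<close> appears; it
        contributes the factor \<open>W\<close>, the numerator of
        \<open>u - \<alpha>\<close>.\<close>
      also have "\<dots> = - g * (y x * Z x * K x + (1 - (y x)\<^sup>2) * (\<delta> - 1) * K x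
          + (1 - (y x)\<^sup>2) * (K x * (\<delta> - 1) - Z x * J x))"
        unfolding y1_sq y2_eq by algebra
      also have "\<dots> = - ((- g * (1 - y x) + g * \<delta> * (1 + y x)) * K x
          + 2 * (- g * (1 - y x)) * (g * \<delta> * (1 + y x)) * W x)"
        unfolding ids(2) unfolding Z_def by algebra
      finally have "4 * \<delta> * g * (y2 x * Z x - 2 * (\<delta> - 1) * (y1 x)\<^sup>2) / (Z x) ^ 3 = \<dots> / (Z x) ^ 3"
        by (rule arg_cong)
      also have "\<dots> = 2 * (e + c * ?u x - 2 * (?u x) ^ 3)"
      proof -
        have "- ((p + q) * k + 2 * p * q * w) / z ^ 3 =
            - ((p / z + q / z) * (k / z\<^sup>2) + 2 * (p / z) * (q / z) * (w / z))" for p q k w z :: real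
          by (simp add: add_divide_distrib diff_divide_distrib distrib_right power2_eq_square power3_eq_cube mult.assoc)
        then show ?thesis
          unfolding quartic_complex_roots_identities(2)[OF wave_B_params_roots[OF params]] X3
          unfolding ua ub u\<alpha> .
      qed
      finally show ?thesis
        by simp
    qed
    also have "\<dots> = e + c * ?u x - 2 * (?u x) ^ 3"
      by simp
    finally show "((\<lambda>x. g * (2 * \<delta> * y1 x) / (Z x)\<^sup>2) has_real_derivative
        e + c * ?u x - 2 * (?u x) ^ 3) (at x)" .
    have "(g * (2 * \<delta> * y1 x) / (Z x)\<^sup>2)\<^sup>2 = g\<^sup>2 * \<delta> * (4 * \<delta> * (y1 x)\<^sup>2) / (Z x) ^ 4"
      by (simp add: power_divide power_mult_distrib) (simp add: power2_eq_square)
    also have "\<dots> = 2 * e * ?u x - (?u x) ^ 4 + c * (?u x)\<^sup>2 - d"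
      unfolding y1_sq quartic_complex_roots_identities(1)[OF wave_B_params_roots[OF params]] ua ub X3
      using Z_nz by (simp add: field_simps power2_eq_square power4_eq_xxxx)
    finally show "(g * (2 * \<delta> * y1 x) / (Z x)\<^sup>2)\<^sup>2 = 2 * e * ?u x - (?u x) ^ 4 + c * (?u x)\<^sup>2 - d" .
    show "0 < 2 * ellipticF \<kappa> pi / \<nu>"
      using ellipticF_pi_pos pos by simp
    have "jacobi_cn \<kappa> (\<nu> * (x + 2 * ellipticF \<kappa> pi / \<nu>)) = jacobi_cn \<kappa> (\<nu> * x)"
      using pos cn_add_half_period[of "\<nu> * x"] cn_add_half_period[of "\<nu> * x + ellipticF \<kappa> pi"]
      by (simp add: distrib_left add.assoc flip: mult_2)
    then show "?u (x + 2 * ellipticF \<kappa> pi / \<nu>) = ?u x"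
      by (simp add: wave_B_def)
  qed
qed

text \<open>The value \<open>a\<close> taken at 0 recurs only where cn equals 1, because the
  denominator stays positive.\<close>

lemma wave_B_fundamental_period:
  assumes params: "wave_B_params c d e a b \<alpha> \<beta> \<delta> \<nu> \<kappa>"
  shows "fundamental_period (wave_B a b \<delta> \<nu> \<kappa>) (2 * ellipticF \<kappa> pi / \<nu>)"
proof -
  have pos: "0 < \<delta>" "0 < \<nu>" "0 < \<kappa>" "\<kappa> < 1"
    using params by (auto simp: wave_B_params_def)
  interpret jacobi_modulus \<kappa>
    using pos by unfold_locales (simp add: abs_square_less_1)
  obtain v where "mkdv_wave (wave_B a b \<delta> \<nu> \<kappa>) v c d e (2 * ellipticF \<kappa> pi / \<nu>)"
    using wave_B_wave[OF params] .
  then interpret mkdv_wave "wave_B a b \<delta> \<nu> \<kappa>" v c d e "2 * ellipticF \<kappa> pi / \<nu>" .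
  have "2 * ellipticF \<kappa> pi / \<nu> \<le> T" if "0 < T" and T: "periodic_fun_simple (wave_B a b \<delta> \<nu> \<kappa>) T" for T
  proof -
    have cn: "jacobi_cn \<kappa> (\<nu> * T) \<le> 1" "- 1 \<le> jacobi_cn \<kappa> (\<nu> * T)"
      by (simp_all add: jacobi_cn_def)
    have "wave_B a b \<delta> \<nu> \<kappa> T = wave_B a b \<delta> \<nu> \<kappa> 0"
      using T by (metis add_0 periodic_fun_simple_def)
    also have "\<dots> = a"
      by (simp add: wave_B_def jacobi_cn_def)
    finally have "1 - jacobi_cn \<kappa> (\<nu> * T) = 0 \<or> 1 + \<delta> + (\<delta> - 1) * jacobi_cn \<kappa> (\<nu> * T) = 0"
      using wave_B_params_strict[OF params] by (simp add: wave_B_def)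
    moreover have "1 + \<delta> + (\<delta> - 1) * jacobi_cn \<kappa> (\<nu> * T)
        = (1 - jacobi_cn \<kappa> (\<nu> * T)) + \<delta> * (1 + jacobi_cn \<kappa> (\<nu> * T))"
      by (simp add: algebra_simps)
    moreover have "0 \<le> \<delta> * (1 + jacobi_cn \<kappa> (\<nu> * T))"
      using cn pos by simp
    ultimately have "jacobi_cn \<kappa> (\<nu> * T) = 1"
      using cn by linarith
    then show ?thesis
      using cn_eq_1_imp_ge[of "\<nu> * T"] pos \<open>0 < T\<close> by (simp add: field_simps)
  qed
  then show ?thesis
    using period_pos periodic by (simp add: fundamental_period_def periodic_fun_simple_def)
qed

text \<open>The real eigenvalue pairs \<open>a\<close> with \<open>b\<close>, a complex one pairs
  \<open>a\<close> with a nonreal root. The sign left open in \<open>\<beta>'\<close> treats both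
  conjugate eigenvalues at once.\<close>

lemma wave_B_eigenvalues:
  assumes params: "wave_B_params c d e a b \<alpha> \<beta> \<delta> \<nu> \<kappa>"
  defines "u \<equiv> wave_B a b \<delta> \<nu> \<kappa>" and "L \<equiv> 2 * ellipticF \<kappa> pi / \<nu>"
  shows "periodic_eigenvalue u L (of_real ((a + b) / 2))"
    and "periodic_eigenvalue u (2 * L) (of_real ((a + b) / 2))"
    and "\<beta>'\<^sup>2 = \<beta>\<^sup>2 \<Longrightarrow> periodic_eigenvalue u (2 * L) (Complex ((a - b) / 4) (\<beta>' / 2))"
proof -
  note strict = wave_B_params_strict[OF params]
  note roots = wave_B_params_roots[OF params]
  have a: "a = - b - 2 * \<alpha>"
    using roots(1) by simp
  obtain v where "mkdv_wave u v c d e L"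
    using wave_B_wave[OF params] unfolding u_def L_def .
  then interpret mkdv_wave u v c d e L .
  have v_sq: "(v x)\<^sup>2 = - ((u x - a) * (u x - b) * ((u x - \<alpha>)\<^sup>2 + \<beta>\<^sup>2))" for x
    unfolding energy quartic_complex_roots_identities(1)[OF roots] ..
  have \<beta>_pos: "0 < z\<^sup>2 + \<beta>\<^sup>2" for z
    using strict(2) by (simp add: add_nonneg_pos)
  have cases: "u x = a \<or> u x = b" if "v x = 0" for x
    using v_sq[of x] that strict(2) by simp
  have factorization: "mkdv_real_factorization u v c d e L ((a + b) / 2)
    (- (a * b + \<alpha>\<^sup>2 + \<beta>\<^sup>2) / 4) ((\<alpha>\<^sup>2 + \<beta>\<^sup>2 - a * b) / 2)"
  proof unfold_locales
    show "c = 4 * ((a + b) / 2)\<^sup>2 + 4 * (- (a * b + \<alpha>\<^sup>2 + \<beta>\<^sup>2) / 4)"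
      unfolding roots(2) a by (simp add: field_simps power2_eq_square)
    have "2 * e = 2 * (2 * ((a + b) / 2) * ((\<alpha>\<^sup>2 + \<beta>\<^sup>2 - a * b) / 2))"
      unfolding roots(3) a by (simp add: field_simps)
    then show "e = 2 * ((a + b) / 2) * ((\<alpha>\<^sup>2 + \<beta>\<^sup>2 - a * b) / 2)"
      by linarith
    show "d = 4 * (- (a * b + \<alpha>\<^sup>2 + \<beta>\<^sup>2) / 4)\<^sup>2 - ((\<alpha>\<^sup>2 + \<beta>\<^sup>2 - a * b) / 2)\<^sup>2"
      unfolding roots(4) by (simp add: field_simps power2_eq_square)
  qed
  \<comment> \<open>At a turning value \<open>r\<close> the residual is a quarter of the squared
    distance from \<open>r\<close> to the nonreal roots.\<close>
  have less: "- (a * b + \<alpha>\<^sup>2 + \<beta>\<^sup>2) / 4 < (u x)\<^sup>2 / 2" if "v x = 0" for x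
  proof -
    have "a\<^sup>2 / 2 - (- (a * b + \<alpha>\<^sup>2 + \<beta>\<^sup>2) / 4) = ((a - \<alpha>)\<^sup>2 + \<beta>\<^sup>2) / 4"
      "b\<^sup>2 / 2 - (- (a * b + \<alpha>\<^sup>2 + \<beta>\<^sup>2) / 4) = ((b - \<alpha>)\<^sup>2 + \<beta>\<^sup>2) / 4"
      unfolding a by (simp_all add: field_simps power2_eq_square)
    then have "0 < (u x)\<^sup>2 / 2 - (- (a * b + \<alpha>\<^sup>2 + \<beta>\<^sup>2) / 4)"
      using cases[OF that] \<beta>_pos by (metis divide_pos_pos zero_less_numeral)
    then show ?thesis
      by simp
  qed
  then show "periodic_eigenvalue u L (of_real ((a + b) / 2))"
    by (rule mkdv_real_factorization.periodic_eigenvalue_single_period[OF factorization])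
  show "periodic_eigenvalue u (2 * L) (of_real ((a + b) / 2))"
    using less by (intro mkdv_real_factorization.periodic_eigenvalue_double_period[OF factorization]) force
  show "periodic_eigenvalue u (2 * L) (Complex ((a - b) / 4) (\<beta>' / 2))" if \<beta>': "\<beta>'\<^sup>2 = \<beta>\<^sup>2"
  proof -
    \<comment> \<open>The constants of the four-root case for the pairs \<open>a\<close>,
      \<open>\<alpha> + \<i> \<beta>'\<close> and \<open>b\<close>,
      \<open>\<alpha> - \<i> \<beta>'\<close>, simplified by
      \<open>a + b = - 2 \<alpha>\<close>.\<close>
    interpret mkdv_factorization u v c d e L "Complex ((a - b) / 4) (\<beta>' / 2)"
      "Complex (\<alpha>\<^sup>2 / 2) (- (a - b) * \<beta>' / 4)" "Complex (- (a - b) * \<alpha> / 2) (\<alpha> * \<beta>')"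
    proof unfold_locales
      show "of_real c = 4 * (Complex ((a - b) / 4) (\<beta>' / 2))\<^sup>2 + 4 * Complex (\<alpha>\<^sup>2 / 2) (- (a - b) * \<beta>' / 4)"
        unfolding roots(2) a \<beta>'[symmetric] by (simp add: complex_eq_iff field_simps power2_eq_square)
      have "2 * of_real e = complex_of_real (2 * e)"
        by simp
      also have "\<dots> = 2 * (2 * Complex ((a - b) / 4) (\<beta>' / 2) * Complex (- (a - b) * \<alpha> / 2) (\<alpha> * \<beta>'))"
        unfolding roots(3) a \<beta>'[symmetric] by (simp add: complex_eq_iff field_simps power2_eq_square)
      finally show "of_real e = 2 * Complex ((a - b) / 4) (\<beta>' / 2) * Complex (- (a - b) * \<alpha> / 2) (\<alpha> * \<beta>')"
        by simp
      show "of_real d = 4 * (Complex (\<alpha>\<^sup>2 / 2) (- (a - b) * \<beta>' / 4))\<^sup>2 - (Complex (- (a - b) * \<alpha> / 2) (\<alpha> * \<beta>'))\<^sup>2"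
        unfolding roots(4) a \<beta>'[symmetric] by (simp add: complex_eq_iff field_simps power2_eq_square)
    qed
    show ?thesis
    proof (rule periodic_eigenvalue_from_component)
      fix x
      show "S x + of_real (v x) \<noteq> 0"
      proof
        assume "S x + of_real (v x) = 0"
        then have "\<beta>' * u x + \<alpha> * \<beta>' = 0" and re: "(a - b) / 2 * u x - (a - b) * \<alpha> / 2 + v x = 0"
          unfolding S_def by (simp_all add: complex_eq_iff left_diff_distrib diff_divide_distrib)
        then have "\<beta>' * (u x + \<alpha>) = 0"
          by (simp add: algebra_simps)
        then have u: "u x = - \<alpha>"
          using \<beta>' strict(2) by (auto simp: add_eq_0_iff)
        have v: "v x = (a - b) * \<alpha>"
          using re unfolding u by (simp add: field_simps)
        \<comment> \<open>At \<open>u = - \<alpha>\<close>, the midpoint of \<open>a\<close> and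
          \<open>b\<close>, the energy relation exceeds the square of
          \<open>(a - b) \<alpha>\<close> by a quarter of this product.\<close>
        have "(a - b)\<^sup>2 * \<beta>\<^sup>2 = 0"
          using v_sq[of x] unfolding v u a by (simp add: algebra_simps power2_eq_square)
        then show False
          using strict by simp
      qed
    qed
  qed
qed

section \<open>Distinctness of the eigenvalues and their periods\<close>

lemma wave_A_spectrum:
  assumes params: "wave_A_params c d e u1 u2 u3 u4 \<nu> \<kappa>"
  defines "u \<equiv> wave_A u1 u2 u4 \<nu> \<kappa>"
    and "l1 \<equiv> complex_of_real ((u1 + u2) / 2)"
    and "l2 \<equiv> complex_of_real ((u1 + u3) / 2)"
    and "l3 \<equiv> complex_of_real ((u2 + u3) / 2)"
  shows "Re l1 \<noteq> 0 \<and> Re l2 \<noteq> 0 \<and> distinct [l1, - l1, l2, - l2] \<and>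
    (e \<noteq> 0 \<longrightarrow> Re l3 \<noteq> 0 \<and> distinct [l1, - l1, l2, - l2, l3, - l3]) \<and>
    (\<exists>L. fundamental_period u L \<and>
      (\<forall>l\<in>{l1, - l1, l2, - l2, l3, - l3}. periodic_eigenvalue u (2 * L) l) \<and>
      (\<forall>l\<in>{l1, - l1}. periodic_eigenvalue u L l))"
proof (intro conjI impI exI)
  note strict = wave_A_params_strict[OF params] and roots = wave_A_params_roots[OF params]
  have pos: "0 < Re l1" "0 < Re l2"
    using strict roots(1) by (simp_all add: l1_def l2_def)
  then show "Re l1 \<noteq> 0" "Re l2 \<noteq> 0"
    by simp_all
  have "Re l1 \<noteq> Re l2"
    using strict by (simp add: l1_def l2_def)
  with pos show "distinct [l1, - l1, l2, - l2]"
    by (auto simp: complex_eq_iff)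
  \<comment> \<open>Since \<open>l1\<close> and \<open>l2\<close> are positive,
    \<open>e = - 4 l1 l2 l3\<close> leaves \<open>l3\<close> as the only factor that can
    vanish.\<close>
  assume "e \<noteq> 0"
  show l3: "Re l3 \<noteq> 0"
  proof
    assume "Re l3 = 0"
    then have "u3 = - u2" "u4 = - u1"
      using roots(1) by (simp_all add: l3_def)
    then have "2 * e = 0"
      unfolding roots(3) by simp
    with \<open>e \<noteq> 0\<close> show False
      by simp
  qed
  \<comment> \<open>Twice these differences and sums are \<open>u1 - u3\<close>,
    \<open>u1 - u2\<close>, \<open>u2 - u4\<close> and \<open>u3 - u4\<close>.\<close>
  have "Re l1 \<noteq> Re l3" "Re l2 \<noteq> Re l3" "Re l1 + Re l3 \<noteq> 0" "Re l2 + Re l3 \<noteq> 0"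
    using strict roots(1) by (simp_all add: l1_def l2_def l3_def field_simps)
  with pos l3 \<open>Re l1 \<noteq> Re l2\<close> have "distinct (map Re [l1, - l1, l2, - l2, l3, - l3])"
    by auto
  then show "distinct [l1, - l1, l2, - l2, l3, - l3]"
    unfolding distinct_map by (rule conjunct1)
next
  show "fundamental_period u (ellipticF \<kappa> pi / \<nu>)"
    unfolding u_def by (rule wave_A_fundamental_period[OF params])
  note eig = wave_A_eigenvalues[OF params, folded u_def l1_def l2_def l3_def]
  show "\<forall>l\<in>{l1, - l1, l2, - l2, l3, - l3}. periodic_eigenvalue u (2 * (ellipticF \<kappa> pi / \<nu>)) l"
    "\<forall>l\<in>{l1, - l1}. periodic_eigenvalue u (ellipticF \<kappa> pi / \<nu>) l"
    using eig by (auto intro: periodic_eigenvalue_uminus)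
qed

lemma wave_B_spectrum:
  assumes params: "wave_B_params c d e a b \<alpha> \<beta> \<delta> \<nu> \<kappa>"
  defines "u \<equiv> wave_B a b \<delta> \<nu> \<kappa>"
    and "l1 \<equiv> complex_of_real ((a - b) / 4) + \<i> / 2 * complex_of_real \<beta>"
    and "l2 \<equiv> complex_of_real ((a - b) / 4) - \<i> / 2 * complex_of_real \<beta>"
    and "l3 \<equiv> complex_of_real ((a + b) / 2)"
  shows "Re l1 \<noteq> 0 \<and> Re l2 \<noteq> 0 \<and> distinct [l1, - l1, l2, - l2] \<and>
    (e \<noteq> 0 \<longrightarrow> Re l3 \<noteq> 0 \<and> distinct [l1, - l1, l2, - l2, l3, - l3]) \<and>
    (\<exists>L. fundamental_period u L \<and>
      (\<forall>l\<in>{l1, - l1, l2, - l2, l3, - l3}. periodic_eigenvalue u (2 * L) l) \<and>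
      (\<forall>l\<in>{l3, - l3}. periodic_eigenvalue u L l))"
proof -
  note strict = wave_B_params_strict[OF params] and roots = wave_B_params_roots[OF params]
  define p where "p = (a - b) / 4"
  have p: "0 < p"
    using strict by (simp add: p_def)
  have l1: "l1 = Complex p (\<beta> / 2)" and l2: "l2 = Complex p (- \<beta> / 2)"
    by (simp_all add: l1_def l2_def p_def complex_eq_iff)
  show ?thesis
  proof (intro conjI impI exI)
    show "Re l1 \<noteq> 0" "Re l2 \<noteq> 0" "distinct [l1, - l1, l2, - l2]"
      using p strict(2) by (auto simp: l1 l2 complex_eq_iff)
    \<comment> \<open>Here \<open>e = 4 l1 l2 l3\<close>, and \<open>l1 l2\<close> is positive
      because \<open>l1\<close> and \<open>l2\<close> are conjugate and nonzero.\<close>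
    assume "e \<noteq> 0"
    show l3: "Re l3 \<noteq> 0"
    proof
      assume "Re l3 = 0"
      then have "b = - a" "\<alpha> = 0"
        using roots(1) by (simp_all add: l3_def)
      then have "2 * e = 0"
        unfolding roots(3) by simp
      with \<open>e \<noteq> 0\<close> show False
        by simp
    qed
    then show "distinct [l1, - l1, l2, - l2, l3, - l3]"
      using p strict(2) by (auto simp: l1 l2 l3_def complex_eq_iff)
  next
    show "fundamental_period u (2 * ellipticF \<kappa> pi / \<nu>)"
      unfolding u_def by (rule wave_B_fundamental_period[OF params])
    note eig = wave_B_eigenvalues(1,2)[OF params, folded u_def l3_def]
      wave_B_eigenvalues(3)[OF params refl, folded u_def p_def, folded l1]
      wave_B_eigenvalues(3)[OF params power2_minus, folded u_def p_def, folded l2]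
    show "\<forall>l\<in>{l1, - l1, l2, - l2, l3, - l3}. periodic_eigenvalue u (2 * (2 * ellipticF \<kappa> pi / \<nu>)) l"
      "\<forall>l\<in>{l3, - l3}. periodic_eigenvalue u (2 * ellipticF \<kappa> pi / \<nu>) l"
      using eig by (auto intro: periodic_eigenvalue_uminus)
  qed
qed

theorem theorem2:
  fixes c d e u1 u2 u3 u4 a b \<alpha> \<beta> \<delta> \<nu> \<kappa> :: real
  shows
    "(wave_A_params c d e u1 u2 u3 u4 \<nu> \<kappa> \<longrightarrow>
       (let u = wave_A u1 u2 u4 \<nu> \<kappa>;
            l1 = complex_of_real ((u1 + u2) / 2);
            l2 = complex_of_real ((u1 + u3) / 2);
            l3 = complex_of_real ((u2 + u3) / 2)
        in Re l1 \<noteq> 0 \<and> Re l2 \<noteq> 0 \<and> distinct [l1, - l1, l2, - l2] \<and>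
           (e \<noteq> 0 \<longrightarrow> Re l3 \<noteq> 0 \<and> distinct [l1, - l1, l2, - l2, l3, - l3]) \<and>
           (\<exists>L. fundamental_period u L \<and>
                (\<forall>l\<in>{l1, - l1, l2, - l2, l3, - l3}. periodic_eigenvalue u (2 * L) l) \<and>
                (\<forall>l\<in>{l1, - l1}. periodic_eigenvalue u L l)))) \<and>
     (wave_B_params c d e a b \<alpha> \<beta> \<delta> \<nu> \<kappa> \<longrightarrow>
       (let u = wave_B a b \<delta> \<nu> \<kappa>;
            l1 = complex_of_real ((a - b) / 4) + \<i> / 2 * complex_of_real \<beta>;
            l2 = complex_of_real ((a - b) / 4) - \<i> / 2 * complex_of_real \<beta>;
            l3 = complex_of_real ((a + b) / 2)
        in Re l1 \<noteq> 0 \<and> Re l2 \<noteq> 0 \<and> distinct [l1, - l1, l2, - l2] \<and>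
           (e \<noteq> 0 \<longrightarrow> Re l3 \<noteq> 0 \<and> distinct [l1, - l1, l2, - l2, l3, - l3]) \<and>
           (\<exists>L. fundamental_period u L \<and>
                (\<forall>l\<in>{l1, - l1, l2, - l2, l3, - l3}. periodic_eigenvalue u (2 * L) l) \<and>
                (\<forall>l\<in>{l3, - l3}. periodic_eigenvalue u L l))))"
  unfolding Let_def by (rule conjI; rule impI; erule wave_A_spectrum wave_B_spectrum)

end
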